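(* Let $(X,d,\mu)$ be a geodesic $D$-doubling metric measure space. If $(X,d,\mu)$ satisfies a $(1,p)$-Poincaré inequality (for some $p\in[1,\infty)$) and $\nu\in A_\infty(\mu)$, then there is some $q\in[1,\infty)$ such that $(X,d,\nu)$ satisfies a $(1,q)$-Poincaré inequality.
   Context: Standing assumptions: metric measure spaces $(X,d,\mu)$ are complete and separable, $\mu$ is a Radon measure, and $0<\mu(B(x,r))<\infty$ for all open balls. $D$-doubling: $\mu(B(x,2r))\le D\,\mu(B(x,r))$ for all $x\in X$, $r>0$. Geodesic: any $x,y\in X$ are joined by a Lipschitz curve of length at most $d(x,y)$. $A_\infty(\mu)$: a Radon measure $\nu$ on $X$ belongs to $A_\infty(\mu)$ if $\nu=w\mu$ for some $w$, and there exist $\epsilon,\delta\in(0,1)$ such that for every ball $B(x,r)$ and every Borel set $E\subset B(x,r)$: $\nu(E)\le\delta\,\nu(B(x,r))$ implies $\mu(E)\le\epsilon\,\mu(B(x,r))$. $(1,p)$-Poincaré inequality for $(X,d,m)$: with $\mathrm{lip} f(x)=\liminf_{r\to0}\sup_{y\in B(x,r)}|f(x)-f(y)|/r$, there are $C,C_{PI}>0$ such that for all $x\in X$, $r>0$ and Lipschitz $f:X\to\mathbb{R}$, $$\frac{1}{m(B(x,r))}\int_{B(x,r)}|f-f_{B(x,r)}|\,dm\le C_{PI}\,r\left(\frac{1}{m(B(x,Cr))}\int_{B(x,Cr)}(\mathrm{lip} f)^p\,dm\right)^{1/p},$$ where $f_B$ is the $m$-average of $f$ over $B$. *)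

theory Defs
  imports "HOL-Analysis.Analysis"
begin

text \<open>
  The metric space is the type itself, of class \<open>polish_space\<close>: its fixed metric \<^term>\<open>dist\<close> is
  complete and the space is separable. Balls are open and have positive radius.
\<close>

definition radon_measure :: "'a::metric_space measure \<Rightarrow> bool" where
  "radon_measure M \<longleftrightarrow>
     sets M = sets borel \<and>
     (\<forall>K. compact K \<longrightarrow> emeasure M K < \<infinity>) \<and>
     (\<forall>V. open V \<longrightarrow> emeasure M V = (SUP K \<in> {K. K \<subseteq> V \<and> compact K}. emeasure M K)) \<and>
     (\<forall>A\<in>sets borel. emeasure M A = (INF U \<in> {U. A \<subseteq> U \<and> open U}. emeasure M U))"

definition metric_measure_space :: "'a::polish_space measure \<Rightarrow> bool" where
  "metric_measure_space M \<longleftrightarrow>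
     radon_measure M \<and>
     (\<forall>x r. r > 0 \<longrightarrow> 0 < emeasure M (ball x r) \<and> emeasure M (ball x r) < \<infinity>)"

definition doubling_measure :: "real \<Rightarrow> 'a::polish_space measure \<Rightarrow> bool" where
  "doubling_measure D M \<longleftrightarrow>
     (\<forall>x r. r > 0 \<longrightarrow> emeasure M (ball x (2 * r)) \<le> ennreal D * emeasure M (ball x r))"

text \<open>
  Length of a curve parametrised by \<open>[0,1]\<close>: the supremum, over all
  \<open>0 \<le> t 0 \<le> \<dots> \<le> t n \<le> 1\<close>, of the sums of the distances between consecutive points.
\<close>

definition curve_length :: "(real \<Rightarrow> 'a::metric_space) \<Rightarrow> ennreal" where
  "curve_length g =
     (SUP (n, t) \<in> {(n::nat, t::nat \<Rightarrow> real). mono_on {..n} t \<and> t ` {..n} \<subseteq> {0..1}}.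
        \<Sum>i<n. ennreal (dist (g (t i)) (g (t (Suc i)))))"

definition geodesic_space :: "'a::metric_space itself \<Rightarrow> bool" where
  "geodesic_space _ \<longleftrightarrow>
     (\<forall>x y::'a. \<exists>g. (\<exists>L. L-lipschitz_on {0..1} g) \<and> pathstart g = x \<and> pathfinish g = y \<and>
        curve_length g \<le> ennreal (dist x y))"

definition A_infinity :: "'a::polish_space measure \<Rightarrow> 'a measure set" where
  "A_infinity M = {N.
     radon_measure N \<and>
     (\<exists>w \<in> borel_measurable borel. N = density M w) \<and>
     (\<exists>\<epsilon> \<delta>::real. 0 < \<epsilon> \<and> \<epsilon> < 1 \<and> 0 < \<delta> \<and> \<delta> < 1 \<and>
        (\<forall>x r E. r > 0 \<and> E \<in> sets borel \<and> E \<subseteq> ball x r \<and>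
           emeasure N E \<le> ennreal \<delta> * emeasure N (ball x r) \<longrightarrow>
           emeasure M E \<le> ennreal \<epsilon> * emeasure M (ball x r)))}"

definition lower_lip :: "('a::metric_space \<Rightarrow> real) \<Rightarrow> 'a \<Rightarrow> ennreal" where
  "lower_lip f x =
     Liminf (at_right 0) (\<lambda>r. SUP y \<in> ball x r. ennreal (\<bar>f x - f y\<bar> / r))"

definition mean_value :: "'a measure \<Rightarrow> 'a set \<Rightarrow> ('a \<Rightarrow> real) \<Rightarrow> real" where
  "mean_value M A f = (LINT x:A|M. f x) / measure M A"

text \<open>
  The real-valued integrals below lose nothing when \<open>metric_measure_space M\<close> holds: balls have
  finite positive measure, Lipschitz functions are bounded on balls, and for \<open>f\<close> Lipschitz with
  constant \<open>L\<close> the function \<open>lower_lip f\<close> is Borel (the balls in its definition being open) and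
  bounded by \<open>L\<close>, so that \<^const>\<open>enn2real\<close> is applied to finite values only.
\<close>

definition poincare_inequality :: "real \<Rightarrow> 'a::polish_space measure \<Rightarrow> bool" where
  "poincare_inequality p M \<longleftrightarrow>
     (\<exists>C C_PI::real. C > 0 \<and> C_PI > 0 \<and>
       (\<forall>x r. \<forall>f::'a \<Rightarrow> real. r > 0 \<and> (\<exists>L. L-lipschitz_on UNIV f) \<longrightarrow>
          mean_value M (ball x r) (\<lambda>y. \<bar>f y - mean_value M (ball x r) f\<bar>)
          \<le> C_PI * r *
             (mean_value M (ball x (C * r)) (\<lambda>y. enn2real (lower_lip f y) powr p)) powr (1 / p)))"

end

theory Submission
  imports Defs
begin

text \<open>
  Write \<open>g = lip f\<close>. If the averages of \<open>g\<^sup>p\<close> with respect to \<open>\<mu>\<close> over small balls centred at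
  \<open>y\<close> are under control, telescoping the \<open>\<mu>\<close>-means of \<open>f\<close> over balls shrinking to \<open>y\<close> bounds
  \<open>\<bar>f y - c\<bar>\<close>, where \<open>c\<close> is the \<open>\<mu>\<close>-mean of \<open>f\<close> over the given ball. This bound holds at every
  point and mentions \<open>\<mu>\<close> only through the averages of \<open>g\<^sup>p\<close>. It remains to replace these by
  \<open>\<nu>\<close>-averages of a higher power \<open>g\<^sup>q\<close> and to integrate the resulting maximal function against \<open>\<nu>\<close>.

  The replacement (\<open>average_transfer\<close>) rests on a power law: \<open>\<mu>(E)/\<mu>(B)\<close> is at most a constant
  times a positive power of \<open>\<nu>(E)/\<nu>(B)\<close> for \<open>E \<subseteq> B\<close> (\<open>power_decay\<close>). If the \<open>\<nu>\<close>-density of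
  an open set \<open>E\<close> is small at a large scale, then around each of its points there is a ball in which
  this density is comparable to \<open>\<delta>\<close> but at most \<open>\<delta>\<close>. By hypothesis a definite \<open>\<mu>\<close>-proportion of
  such a ball lies outside \<open>E\<close>. Hence the union \<open>E'\<close> of these balls satisfies
  \<open>\<mu>(E) \<le> \<theta> \<mu>(E')\<close> with \<open>\<theta> < 1\<close>, while \<open>\<nu>(E') \<le> \<kappa> \<nu>(E)\<close> (\<open>enlargement_step\<close>). This can be
  repeated about \<open>log (\<nu>(B)/\<nu>(E))\<close> times.

  Both this argument and the maximal inequality need \<open>\<nu>\<close> to be doubling, and here the geodesics enter:
  they make thin annuli \<open>\<mu>\<close>-small (\<open>thin_annulus\<close>), so a slightly smaller concentric ball has
  \<open>\<mu>\<close>-proportion above \<open>\<epsilon>\<close> and therefore \<open>\<nu>\<close>-proportion above \<open>\<delta>\<close>; iterating this halves the radius.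

  All the covering arguments are instances of \<open>vitali_transfer\<close>: an inequality between a doubling
  measure and any other measure passes from a family of balls to their union.

  For the last step, with \<open>q = p s\<close> and \<open>s \<ge> 2\<close>, the weak type inequality for the maximal function of
  \<open>g\<^sup>q\<close> bounds \<open>\<nu>(\<bar>f - c\<bar> > t)\<close> by a multiple of \<open>t\<^sup>-\<^sup>q\<close>. As \<open>q \<ge> 2 > 1\<close> this tail is
  integrable, which yields the \<open>(1,q)\<close>-inequality for \<open>\<nu>\<close> (\<open>poincare_transfer\<close>).
\<close>

section \<open>Covering by balls of a doubling measure\<close>

text \<open>
  Greedy choice: keep a ball of largest radius, discard the balls that meet it (they lie in its
  threefold dilation), and recurse.
\<close>

lemma finite_vitali:
  fixes r :: "'a::metric_space \<Rightarrow> real"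
  assumes "finite I" and "\<And>x. x \<in> I \<Longrightarrow> 0 < r x"
  shows "\<exists>J\<subseteq>I. disjoint_family_on (\<lambda>x. ball x (r x)) J \<and>
           (\<Union>x\<in>I. ball x (r x)) \<subseteq> (\<Union>x\<in>J. ball x (3 * r x))"
  using assms
proof (induction "card I" arbitrary: I rule: less_induct)
  case less
  show ?case
  proof (cases "I = {}")
    case True
    then show ?thesis by (auto simp: disjoint_family_on_def)
  next
    case False
    then obtain z where z: "z \<in> I" "\<And>x. x \<in> I \<Longrightarrow> r x \<le> r z"
      using Max_in[of "r ` I"] Max_ge[of "r ` I"] less.prems(1) by fastforce
    define I' where "I' = {x \<in> I. ball x (r x) \<inter> ball z (r z) = {}}"
    have "z \<in> ball z (r z)" using z(1) less.prems(2)[of z] by simp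
    then have "z \<notin> I'" unfolding I'_def by blast
    moreover have "I' \<subseteq> I" by (auto simp: I'_def)
    ultimately have "I' \<subset> I" using z(1) by blast
    then have "card I' < card I" "finite I'"
      using less.prems(1) by (auto intro: psubset_card_mono finite_subset)
    from less.hyps[OF this] obtain J where J: "J \<subseteq> I'"
      "disjoint_family_on (\<lambda>x. ball x (r x)) J"
      "(\<Union>x\<in>I'. ball x (r x)) \<subseteq> (\<Union>x\<in>J. ball x (3 * r x))"
      using less.prems(2) by (auto simp: I'_def)
    have "disjoint_family_on (\<lambda>x. ball x (r x)) (insert z J)"
      using J(1,2) unfolding I'_def disjoint_family_on_def by blast
    moreover have "(\<Union>x\<in>I. ball x (r x)) \<subseteq> (\<Union>x\<in>insert z J. ball x (3 * r x))"
    proof safe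
      fix x y assume x: "x \<in> I" and y: "y \<in> ball x (r x)"
      show "y \<in> (\<Union>x\<in>insert z J. ball x (3 * r x))"
      proof (cases "x \<in> I'")
        case True
        with y J(3) show ?thesis by blast
      next
        case False
        with x obtain u where u: "dist x u < r x" "dist z u < r z" by (auto simp: I'_def)
        have "dist z y \<le> dist z u + dist x u + dist x y"
          using dist_triangle[of z y u] dist_triangle[of u y x] by (simp add: dist_commute)
        also have "\<dots> < 3 * r z" using u y z(2)[OF x] by auto
        finally show ?thesis by auto
      qed
    qed
    moreover have "insert z J \<subseteq> I" using z(1) J(1) by (auto simp: I'_def)
    ultimately show ?thesis by blast
  qed
qed

text \<open>
  Finiteness is asked for arbitrary radii because balls of nonpositive radius are empty.
\<close>

locale doubling_radon =
  fixes M :: "'a::polish_space measure" and D :: real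
  assumes radon: "radon_measure M"
    and ball_pos: "\<And>x r. 0 < r \<Longrightarrow> 0 < emeasure M (ball x r)"
    and ball_finite: "\<And>x r. emeasure M (ball x r) < \<infinity>"
    and ball_double: "\<And>x r. 0 < r \<Longrightarrow> emeasure M (ball x (2 * r)) \<le> ennreal D * emeasure M (ball x r)"
begin

lemma sets_eq_borel [simp]: "sets M = sets borel"
  using radon by (simp add: radon_measure_def)

lemma measurable_eq_borel [simp]: "measurable M = measurable borel"
  by (intro ext measurable_cong_sets) simp_all

lemma ball_fmeasurable [simp]: "ball x r \<in> fmeasurable M"
  using ball_finite by (simp add: fmeasurable_def)

lemma fmeasurable_in_ball: "A \<in> sets borel \<Longrightarrow> A \<subseteq> ball x r \<Longrightarrow> A \<in> fmeasurable M"
  using fmeasurableI2[OF ball_fmeasurable] by auto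

lemma measure_ball_pos: "0 < r \<Longrightarrow> 0 < measure M (ball x r)"
  using ball_pos[of r x] ball_finite[of x r]
  by (simp add: measure_def enn2real_positive_iff)

lemma emeasure_ball: "emeasure M (ball x r) = ennreal (measure M (ball x r))"
  using ball_finite[of x r] by (simp add: emeasure_eq_ennreal_measure)

lemma doubling_constant_ge_1: "1 \<le> D"
proof -
  have "emeasure M (ball undefined 1) \<le> emeasure M (ball undefined (2 * 1))"
    by (rule emeasure_mono) auto
  also have "\<dots> \<le> ennreal D * emeasure M (ball undefined 1)" by (rule ball_double) simp
  finally have 1: "ennreal (measure M (ball undefined 1)) \<le> ennreal D * ennreal (measure M (ball undefined 1))"
    by (simp add: emeasure_ball)
  have p: "0 < measure M (ball undefined 1)" by (rule measure_ball_pos) simp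
  have "D \<ge> 0"
    using 1 p by (cases "0 \<le> D") (auto simp: ennreal_neg)
  then show ?thesis using 1 p by (simp add: ennreal_mult[symmetric])
qed

lemma measure_double: "0 < r \<Longrightarrow> measure M (ball x (2 * r)) \<le> D * measure M (ball x r)"
  using ball_double[of r x] doubling_constant_ge_1 by (simp add: emeasure_ball ennreal_mult[symmetric])

lemma measure_double_power:
  assumes "0 < r"
  shows "measure M (ball x (2 ^ n * r)) \<le> D ^ n * measure M (ball x r)"
proof (induction n)
  case (Suc n)
  have "measure M (ball x (2 ^ Suc n * r)) \<le> D * measure M (ball x (2 ^ n * r))"
    using measure_double[of "2 ^ n * r" x] assms by (simp add: mult.assoc)
  also have "\<dots> \<le> D * (D ^ n * measure M (ball x r))"
    using Suc doubling_constant_ge_1 by (intro mult_left_mono) auto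
  finally show ?case by (simp add: mult.assoc)
qed simp

text \<open>
  Taking for \<open>A\<close> a ball with another centre, this compares balls with different centres.
\<close>

lemma measure_ball_comparison:
  assumes "0 < r" and "A \<in> sets borel" and "A \<subseteq> ball x (2 ^ n * r)"
  shows "measure M A \<le> D ^ n * measure M (ball x r)"
proof -
  have "measure M A \<le> measure M (ball x (2 ^ n * r))"
    using assms by (intro measure_mono_fmeasurable) auto
  then show ?thesis using measure_double_power[OF assms(1), of x n] by linarith
qed

lemma open_inner_regular:
  "open V \<Longrightarrow> (\<And>K. compact K \<Longrightarrow> K \<subseteq> V \<Longrightarrow> emeasure M K \<le> b) \<Longrightarrow> emeasure M V \<le> b"
  using radon unfolding radon_measure_def by (auto intro!: SUP_least)

text \<open>
  By inner regularity it suffices to bound a compact subset of the union. It is covered by finitely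
  many of the balls, hence by the threefold dilations of disjoint ones. Dilation costs the factor
  \<open>D\<^sup>2\<close>, and over disjoint balls the hypothesis can be summed. Centres are the indices, so each
  point carries one radius.
\<close>

lemma vitali_transfer:
  assumes N: "sets N = sets borel" and c: "0 \<le> c"
    and r: "\<And>x. x \<in> S \<Longrightarrow> 0 < r x"
    and le: "\<And>x. x \<in> S \<Longrightarrow> emeasure M (ball x (r x)) \<le> ennreal c * emeasure N (ball x (r x))"
  shows "emeasure M (\<Union>x\<in>S. ball x (r x)) \<le> ennreal (D\<^sup>2 * c) * emeasure N (\<Union>x\<in>S. ball x (r x))"
proof (rule open_inner_regular)
  show "open (\<Union>x\<in>S. ball x (r x))" by auto
  fix K assume K: "compact K" "K \<subseteq> (\<Union>x\<in>S. ball x (r x))"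
  then obtain I where I: "I \<subseteq> S" "finite I" "K \<subseteq> (\<Union>x\<in>I. ball x (r x))"
    using compactE_image[of K S "\<lambda>x. ball x (r x)"] by auto
  obtain J where J: "J \<subseteq> I" "disjoint_family_on (\<lambda>x. ball x (r x)) J"
      "(\<Union>x\<in>I. ball x (r x)) \<subseteq> (\<Union>x\<in>J. ball x (3 * r x))"
    using finite_vitali[of I r] I r by blast
  have "finite J" using J(1) I(2) finite_subset by blast
  have triple: "emeasure M (ball x (3 * r x)) \<le> ennreal (D\<^sup>2 * c) * emeasure N (ball x (r x))"
    if "x \<in> J" for x
  proof -
    have x: "x \<in> S" using that J(1) I(1) by auto
    have "measure M (ball x (3 * r x)) \<le> D\<^sup>2 * measure M (ball x (r x))"
      using r[OF x] by (intro measure_ball_comparison) auto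
    then have "emeasure M (ball x (3 * r x)) \<le> ennreal (D\<^sup>2) * emeasure M (ball x (r x))"
      by (simp add: emeasure_ball ennreal_mult[symmetric] del: ennreal_power)
    also have "\<dots> \<le> ennreal (D\<^sup>2) * (ennreal c * emeasure N (ball x (r x)))"
      by (intro mult_left_mono le[OF x]) auto
    finally show ?thesis using c by (simp add: ennreal_mult mult.assoc)
  qed
  have "emeasure M K \<le> emeasure M (\<Union>x\<in>J. ball x (3 * r x))"
    using I J by (intro emeasure_mono) (auto intro!: borel_open)
  also have "\<dots> \<le> (\<Sum>x\<in>J. emeasure M (ball x (3 * r x)))"
    using \<open>finite J\<close> by (intro emeasure_subadditive_finite) auto
  also have "\<dots> \<le> (\<Sum>x\<in>J. ennreal (D\<^sup>2 * c) * emeasure N (ball x (r x)))"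
    by (intro sum_mono triple)
  also have "\<dots> = ennreal (D\<^sup>2 * c) * emeasure N (\<Union>x\<in>J. ball x (r x))"
    using sum_emeasure[of "\<lambda>x. ball x (r x)" J N] \<open>finite J\<close> J(2) N
    by (simp add: sum_distrib_left[symmetric] image_subset_iff)
  also have "\<dots> \<le> ennreal (D\<^sup>2 * c) * emeasure N (\<Union>x\<in>S. ball x (r x))"
    using J I N by (intro mult_left_mono emeasure_mono) (auto intro!: borel_open)
  finally show "emeasure M K \<le> ennreal (D\<^sup>2 * c) * emeasure N (\<Union>x\<in>S. ball x (r x))" .
qed

text \<open>
  The case where the second measure is the restriction of \<open>M\<close> to \<open>A\<close>: if \<open>A\<close> occupies a definite
  proportion of each ball, then it occupies a definite proportion of their union.
\<close>

lemma vitali_restricted: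
  assumes A: "A \<in> sets borel" and c: "0 \<le> c"
    and r: "\<And>y. y \<in> S \<Longrightarrow> 0 < r y"
    and le: "\<And>y. y \<in> S \<Longrightarrow> measure M (ball y (r y)) \<le> c * measure M (A \<inter> ball y (r y))"
    and bounded: "(\<Union>y\<in>S. ball y (r y)) \<subseteq> ball x R"
  shows "measure M (\<Union>y\<in>S. ball y (r y)) \<le> D\<^sup>2 * c * measure M (A \<inter> (\<Union>y\<in>S. ball y (r y)))"
proof -
  let ?U = "\<Union>y\<in>S. ball y (r y)"
  define N where "N = density M (indicator A)"
  have N: "emeasure N B = emeasure M (A \<inter> B)" if "B \<in> sets borel" for B
    unfolding N_def using that A by (subst emeasure_density) (auto simp: indicator_inter_arith[symmetric])
  have U: "?U \<in> sets borel" by (intro borel_open open_UN ballI open_ball)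
  have fm: "B \<in> fmeasurable M \<Longrightarrow> A \<inter> B \<in> fmeasurable M" for B
    using A by (subst Int_commute) (rule fmeasurable_Int_fmeasurable, auto)
  have "emeasure M ?U \<le> ennreal (D\<^sup>2 * c) * emeasure N ?U"
  proof (rule vitali_transfer[OF _ c r])
    fix y assume y: "y \<in> S"
    have "ennreal (measure M (ball y (r y))) \<le> ennreal (c * measure M (A \<inter> ball y (r y)))"
      by (intro ennreal_leI le y)
    then show "emeasure M (ball y (r y)) \<le> ennreal c * emeasure N (ball y (r y))"
      using c fm[of "ball y (r y)"] by (simp add: N emeasure_eq_measure2 ennreal_mult)
  qed (auto simp: N_def)
  moreover have "?U \<in> fmeasurable M" by (rule fmeasurable_in_ball[OF U bounded])
  ultimately show ?thesis
    using fm[of ?U] c by (simp only: N[OF U] emeasure_eq_measure2) (simp add: ennreal_mult[symmetric] del: ennreal_power)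
qed

end

section \<open>Integrals from geometric tails\<close>

text \<open>
  Where \<open>A * b ^ k < h \<le> A * b ^ Suc k\<close> the function \<open>h\<close> is dominated by the \<open>k\<close>-th term of a
  series of indicators, whose integrals form a geometric series of ratio \<open>b * q < 1\<close>.
\<close>

lemma layer_cake_geometric:
  fixes h :: "'a \<Rightarrow> real"
  assumes B[measurable]: "B \<in> fmeasurable M" and h[measurable]: "h \<in> borel_measurable M"
    and b: "1 < b" "0 \<le> q" "b * q < 1" and A: "0 < A" and C: "0 \<le> C"
    and tail: "\<And>k. measure M {x \<in> B. A * b ^ k < h x} \<le> C * q ^ k"
  shows "(\<integral>\<^sup>+x\<in>B. ennreal (h x) \<partial>M) \<le> ennreal (A * (measure M B + C * b / (1 - b * q)))"
proof -
  let ?E = "\<lambda>k. {x \<in> B. A * b ^ k < h x}"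
  have B_sets[measurable]: "B \<in> sets M" using B by auto
  have sp: "x \<in> B \<Longrightarrow> x \<in> space M" for x using sets.sets_into_space[OF B_sets] by auto
  have "?E k = {x \<in> space M. A * b ^ k < h x} \<inter> B" for k using sp by auto
  then have E[measurable]: "?E k \<in> sets M" for k by simp
  have E_fm: "?E k \<in> fmeasurable M" for k by (rule fmeasurableI2[OF B _ E]) auto
  have pt: "ennreal (h x) * indicator B x
      \<le> ennreal A * indicator B x + (\<Sum>k. ennreal (A * b ^ Suc k) * indicator (?E k) x)" for x
  proof (cases "x \<in> B \<and> A < h x")
    case False
    then have "ennreal (h x) * indicator B x \<le> ennreal A * indicator B x"
      by (auto intro!: mult_right_mono ennreal_leI split: split_indicator)
    then show ?thesis by (rule add_increasing2[OF zero_le])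
  next
    case True
    obtain n where "h x / A < b ^ n" using real_arch_pow[OF b(1)] by blast
    then have "h x \<le> A * b ^ n" using A by (simp add: field_simps)
    then have ex: "\<exists>n. h x \<le> A * b ^ n" by blast
    define n where "n = (LEAST n. h x \<le> A * b ^ n)"
    have n: "h x \<le> A * b ^ n" unfolding n_def using ex by (rule LeastI_ex)
    have "n \<noteq> 0" using n True by (cases n) auto
    then obtain k where k: "n = Suc k" using not0_implies_Suc by blast
    have "A * b ^ k < h x" using not_less_Least[of k "\<lambda>n. h x \<le> A * b ^ n"] k n_def by auto
    then have "ennreal (h x) * indicator B x \<le> ennreal (A * b ^ Suc k) * indicator (?E k) x"
      using n True unfolding k by (simp add: ennreal_leI)
    also have "\<dots> = (\<Sum>i\<in>{k}. ennreal (A * b ^ Suc i) * indicator (?E i) x)"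
      by (simp only: sum.insert finite.emptyI empty_iff sum.empty add_0_right not_False_eq_True)
    also have "\<dots> \<le> (\<Sum>k. ennreal (A * b ^ Suc k) * indicator (?E k) x)"
      by (rule sum_le_suminf) auto
    finally show ?thesis by (rule add_increasing[OF zero_le])
  qed
  have "(\<integral>\<^sup>+x\<in>B. ennreal (h x) \<partial>M)
      \<le> (\<integral>\<^sup>+x. ennreal A * indicator B x + (\<Sum>k. ennreal (A * b ^ Suc k) * indicator (?E k) x) \<partial>M)"
    by (intro nn_integral_mono pt)
  also have "\<dots> = ennreal A * emeasure M B + (\<Sum>k. ennreal (A * b ^ Suc k) * emeasure M (?E k))"
    by (simp add: nn_integral_add nn_integral_suminf nn_integral_cmult del: indicator_simps)
  also have "(\<Sum>k. ennreal (A * b ^ Suc k) * emeasure M (?E k)) \<le> (\<Sum>k. ennreal (A * C * b * (b * q) ^ k))"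
  proof (intro suminf_le)
    fix k
    have "ennreal (A * b ^ Suc k) * emeasure M (?E k) = ennreal (A * b ^ Suc k * measure M (?E k))"
      using A b E_fm by (simp only: emeasure_eq_measure2) (simp add: ennreal_mult)
    also have "\<dots> \<le> ennreal (A * b ^ Suc k * (C * q ^ k))"
      using A b by (intro ennreal_leI mult_left_mono tail) auto
    also have "A * b ^ Suc k * (C * q ^ k) = A * C * b * (b * q) ^ k"
      by (simp add: power_mult_distrib)
    finally show "ennreal (A * b ^ Suc k) * emeasure M (?E k) \<le> ennreal (A * C * b * (b * q) ^ k)" .
  qed auto
  also have "\<dots> = ennreal (A * C * b / (1 - b * q))"
  proof (rule suminf_ennreal_eq)
    have "(\<lambda>k. A * C * b * (b * q) ^ k) sums (A * C * b * (1 / (1 - b * q)))"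
      using b by (intro sums_mult geometric_sums) auto
    then show "(\<lambda>k. A * C * b * (b * q) ^ k) sums (A * C * b / (1 - b * q))" by simp
  qed (use A b C in auto)
  also have "ennreal A * emeasure M B + ennreal (A * C * b / (1 - b * q))
    = ennreal (A * (measure M B + C * b / (1 - b * q)))"
    using A b C emeasure_eq_measure2[OF B]
    by (simp add: ennreal_mult[symmetric] ennreal_plus[symmetric] algebra_simps del: ennreal_plus)
  finally show ?thesis by (simp add: add_left_mono)
qed

section \<open>Thin annuli and doubling\<close>

lemma geodesic_point_at_distance:
  fixes x y :: "'a::metric_space"
  assumes geo: "geodesic_space TYPE('a)" and a: "0 \<le> a" "a \<le> dist x y"
  obtains z where "dist x z = a" "dist z y \<le> dist x y - a"
proof -
  obtain g L where g: "L-lipschitz_on {0..1} g" "g 0 = x" "g 1 = y"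
      "curve_length g \<le> ennreal (dist x y)"
    using geo unfolding geodesic_space_def pathstart_def pathfinish_def by metis
  \<comment> \<open>The intermediate value theorem gives a point at distance \<open>a\<close> from \<open>x\<close>; the length bound for
    the three-point subdivision \<open>0, t, 1\<close> says that it lies on a shortest path.\<close>
  have "continuous_on {0..1} (\<lambda>t. dist x (g t))"
    using lipschitz_on_continuous_on[OF g(1)] by (intro continuous_intros)
  then obtain t where t: "0 \<le> t" "t \<le> 1" "dist x (g t) = a"
    using IVT'[of "\<lambda>t. dist x (g t)" 0 a 1] a g(2,3) by auto
  define u :: "nat \<Rightarrow> real" where "u i = (if i = 0 then 0 else if i = 1 then t else 1)" for i
  have u: "mono_on {..2} u" "u ` {..2} \<subseteq> {0..1}"
    using t by (auto simp: mono_on_def u_def)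
  have "(\<Sum>i<2. ennreal (dist (g (u i)) (g (u (Suc i))))) \<le> curve_length g"
    unfolding curve_length_def by (rule SUP_upper2[of "(2, u)"]) (use u in auto)
  then have "ennreal (dist x (g t)) + ennreal (dist (g t) y) \<le> ennreal (dist x y)"
    using g by (simp add: numeral_2_eq_2 u_def)
  then have "dist x (g t) + dist (g t) y \<le> dist x y"
    by (simp add: ennreal_plus[symmetric] del: ennreal_plus)
  then show thesis using t that[of "g t"] by auto
qed

context doubling_radon
begin

text \<open>
  From a point \<open>y\<close> of the annulus of relative width \<open>t\<close>, move the distance \<open>2 * t * r\<close> along a
  geodesic towards the centre. The ball of radius \<open>t * r\<close> around the point so reached lies in the
  annulus of width \<open>4 * t\<close> but outside that of width \<open>t\<close>, and it is a definite part of
  \<open>ball y (3 * t * r)\<close>. Hence the difference of the two annuli has measure at least \<open>1 / D ^ 5\<close>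
  times that of the thinner one.
\<close>

lemma annulus_decay_step:
  assumes geo: "geodesic_space TYPE('a)" and r: "0 < r" and t: "0 < t" "t \<le> 1/4"
  shows "measure M (ball x r - ball x ((1 - t) * r))
      \<le> D ^ 5 / (1 + D ^ 5) * measure M (ball x r - ball x ((1 - 4 * t) * r))"
proof -
  define A where "A s = ball x r - ball x ((1 - s) * r)" for s
  have A_sets [measurable]: "A s \<in> sets borel" for s unfolding A_def by auto
  have A_fm: "A s \<in> fmeasurable M" for s
    by (rule fmeasurable_in_ball[OF A_sets, where x = x and r = r]) (auto simp: A_def)
  have sub: "A t \<subseteq> A (4 * t)"
  proof -
    have "(1 - 4 * t) * r \<le> (1 - t) * r" using r t by (intro mult_right_mono) auto
    then show ?thesis by (auto simp: A_def)
  qed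
  have D: "0 \<le> D" using doubling_constant_ge_1 by simp
  have tr: "0 < t * r" "0 < 3 * t * r" "0 \<le> 2 * t * r" using r t by simp_all
  let ?U = "\<Union>y\<in>A t. ball y (3 * t * r)"
  have U_bounded: "?U \<subseteq> ball x (r + 3 * t * r)"
  proof
    fix w assume "w \<in> ?U"
    then obtain y where "dist x y < r" "dist y w < 3 * t * r" by (auto simp: A_def)
    then show "w \<in> ball x (r + 3 * t * r)" using dist_triangle[of x w y] by simp
  qed
  have U: "?U \<in> sets borel" by (intro borel_open open_UN ballI open_ball)
  have "measure M ?U \<le> D\<^sup>2 * D ^ 3 * measure M ((A (4 * t) - A t) \<inter> ?U)"
  proof (rule vitali_restricted[OF _ _ _ _ U_bounded])
    fix y assume y: "y \<in> A t"
    have d: "(1 - t) * r \<le> dist x y" "dist x y < r" using y by (auto simp: A_def)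
    have "t * r \<le> 1/4 * r" using r t by (intro mult_right_mono) auto
    then have "0 \<le> dist x y - 2 * t * r" using d by (simp add: algebra_simps)
    then obtain z where z: "dist x z = dist x y - 2 * t * r" "dist z y \<le> 2 * t * r"
      using geodesic_point_at_distance[OF geo, of "dist x y - 2 * t * r" x y] tr by auto
    have inside: "ball z (t * r) \<subseteq> (A (4 * t) - A t) \<inter> ball y (3 * t * r)"
    proof
      fix w assume "w \<in> ball z (t * r)"
      then have w: "dist z w < t * r" by simp
      have "dist y w < 3 * t * r"
        using dist_triangle[of y w z] w z by (simp add: dist_commute)
      moreover have "dist x w < dist x y - t * r"
        using dist_triangle[of x w z] w z by simp
      moreover have "dist x y - 3 * t * r < dist x w"
        using dist_triangle[of x z w] w z by (simp add: dist_commute)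
      ultimately show "w \<in> (A (4 * t) - A t) \<inter> ball y (3 * t * r)"
        using d tr by (auto simp: A_def algebra_simps)
    qed
    have "ball y (3 * t * r) \<subseteq> ball z (2 ^ 3 * (t * r))"
    proof
      fix w assume "w \<in> ball y (3 * t * r)"
      then show "w \<in> ball z (2 ^ 3 * (t * r))"
        using dist_triangle[of z w y] z(2) tr(1) by (simp add: mult.assoc)
    qed
    then have "measure M (ball y (3 * t * r)) \<le> D ^ 3 * measure M (ball z (t * r))"
      by (intro measure_ball_comparison tr) auto
    also have "measure M (ball z (t * r)) \<le> measure M ((A (4 * t) - A t) \<inter> ball y (3 * t * r))"
      using inside by (intro measure_mono_fmeasurable fmeasurable_in_ball[where x = y and r = "3 * t * r"]) auto
    finally show "measure M (ball y (3 * t * r)) \<le> D ^ 3 * measure M ((A (4 * t) - A t) \<inter> ball y (3 * t * r))"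
      using D by (simp add: mult_left_mono)
  qed (use D tr in auto)
  moreover have "A t \<subseteq> ?U" using tr(2) by (intro subsetI UN_I) (assumption, simp)
  then have "measure M (A t) \<le> measure M ?U"
    by (intro measure_mono_fmeasurable fmeasurable_in_ball[OF U U_bounded]) auto
  moreover have "D\<^sup>2 * D ^ 3 * measure M ((A (4 * t) - A t) \<inter> ?U) \<le> D\<^sup>2 * D ^ 3 * measure M (A (4 * t) - A t)"
    using D U A_fm by (intro mult_left_mono measure_mono_fmeasurable fmeasurable.Diff) auto
  moreover have "D\<^sup>2 * D ^ 3 = D ^ 5" using power_add[of D 2 3] by simp
  ultimately have "measure M (A t) \<le> D ^ 5 * measure M (A (4 * t) - A t)" by simp
  also have "measure M (A (4 * t) - A t) = measure M (A (4 * t)) - measure M (A t)"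
    using fmeasurableD2[OF A_fm[of "4 * t"]] sub by (intro measure_Diff) auto
  finally show ?thesis unfolding A_def[symmetric] using D
    by (simp add: field_simps add_pos_nonneg)
qed

text \<open>
  Only uniform smallness is needed, so the geometric decay along the widths \<open>(1/4) ^ k\<close> is stopped at
  a suitable \<open>k\<close>.
\<close>

lemma thin_annulus:
  assumes geo: "geodesic_space TYPE('a)" and \<eta>: "0 < \<eta>"
  obtains t :: real where "0 < t" "t < 1"
    "\<And>x r. 0 < r \<Longrightarrow> measure M (ball x r - ball x ((1 - t) * r)) \<le> \<eta> * measure M (ball x r)"
proof -
  define \<theta> where "\<theta> = D ^ 5 / (1 + D ^ 5)"
  have "0 < D ^ 5" using doubling_constant_ge_1 by (intro zero_less_power) simp
  then have "0 < 1 + D ^ 5" by (rule add_pos_pos[OF zero_less_one])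
  with \<open>0 < D ^ 5\<close> have \<theta>: "0 < \<theta>" "\<theta> < 1"
    by (simp_all add: \<theta>_def divide_less_eq)
  have decay: "measure M (ball x r - ball x ((1 - (1/4) ^ k) * r)) \<le> \<theta> ^ k * measure M (ball x r)"
    if r: "0 < r" for x r k
  proof (induction k)
    case (Suc k)
    have "measure M (ball x r - ball x ((1 - (1/4) ^ Suc k) * r))
        \<le> \<theta> * measure M (ball x r - ball x ((1 - 4 * (1/4) ^ Suc k) * r))"
      unfolding \<theta>_def using power_le_one[of "1/4::real" k] by (intro annulus_decay_step geo r) auto
    also have "4 * (1/4::real) ^ Suc k = (1/4) ^ k" by simp
    also have "\<theta> * measure M (ball x r - ball x ((1 - (1/4) ^ k) * r)) \<le> \<theta> * (\<theta> ^ k * measure M (ball x r))"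
      using Suc \<theta> by (intro mult_left_mono) auto
    finally show ?case by (simp add: mult.assoc)
  qed simp
  obtain k where k: "\<theta> ^ k < \<eta>" using real_arch_pow_inv[OF \<eta> \<theta>(2)] by blast
  have "measure M (ball x r - ball x ((1 - (1/4) ^ Suc k) * r)) \<le> \<eta> * measure M (ball x r)"
    if r: "0 < r" for x r
  proof -
    have "\<theta> ^ Suc k \<le> \<theta> ^ k" using \<theta> by (intro power_decreasing) auto
    then have "\<theta> ^ Suc k * measure M (ball x r) \<le> \<eta> * measure M (ball x r)"
      using k by (intro mult_right_mono) auto
    with decay[OF r, of x "Suc k"] show ?thesis by linarith
  qed
  moreover have "(1/4::real) ^ Suc k < 1" by (rule power_Suc_less_one) auto
  ultimately show thesis using that[of "(1/4) ^ Suc k"] by auto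
qed

text \<open>
  The \<open>A\<^sub>\<infinity>\<close> condition is used in contrapositive form: a Borel subset of a ball with
  \<open>M\<close>-proportion above \<open>\<epsilon>\<close> has \<open>N\<close>-proportion above \<open>\<delta>\<close>. Applied to a large compact subset it shows
  that \<open>N\<close> is finite on balls, since Radon measures are finite on compact sets; applied to a slightly
  smaller concentric ball it gives doubling.
\<close>

lemma A_infinity_doubling:
  assumes geo: "geodesic_space TYPE('a)" and N: "N \<in> A_infinity M"
  obtains K where "doubling_radon N K"
proof -
  have radon_N: "radon_measure N" using N by (simp add: A_infinity_def)
  then have sets_N: "sets N = sets borel" by (simp add: radon_measure_def)
  obtain \<epsilon> \<delta> where ed: "0 < \<epsilon>" "\<epsilon> < 1" "0 < \<delta>" "\<delta> < 1"
    and A': "\<forall>x r E. 0 < r \<and> E \<in> sets borel \<and> E \<subseteq> ball x r \<and>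
        emeasure N E \<le> ennreal \<delta> * emeasure N (ball x r) \<longrightarrow>
        emeasure M E \<le> ennreal \<epsilon> * emeasure M (ball x r)"
    using N unfolding A_infinity_def mem_Collect_eq by (elim conjE exE) 
  note A = A'[rule_format, OF conjI, OF _ conjI, OF _ _ conjI]
  have strict: "\<not> emeasure M (ball x r) \<le> ennreal \<epsilon> * emeasure M (ball x r)" if "0 < r" for x r
    using measure_ball_pos[OF that, of x] ed by (simp add: emeasure_ball ennreal_mult[symmetric])
  have pos: "0 < emeasure N (ball x r)" if r: "0 < r" for x r
  proof (rule ccontr)
    assume "\<not> 0 < emeasure N (ball x r)"
    then have "emeasure N (ball x r) \<le> ennreal \<delta> * emeasure N (ball x r)" by simp
    from A[OF r _ subset_refl this] strict[OF r] show False by auto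
  qed
  have fin: "emeasure N (ball x r) < \<infinity>" for x r
  proof (cases "0 < r")
    case r: True
    have "\<exists>K. compact K \<and> K \<subseteq> ball x r \<and> \<not> emeasure M K \<le> ennreal \<epsilon> * emeasure M (ball x r)"
      using open_inner_regular[of "ball x r" "ennreal \<epsilon> * emeasure M (ball x r)"] strict[OF r] by auto
    then obtain K where K: "compact K" "K \<subseteq> ball x r"
        "\<not> emeasure M K \<le> ennreal \<epsilon> * emeasure M (ball x r)" by blast
    have "\<not> emeasure N K \<le> ennreal \<delta> * emeasure N (ball x r)"
      using A[OF r _ K(2)] K(1,3) by (auto simp: borel_compact)
    then have "emeasure N (ball x r) \<noteq> \<infinity>" using ed by (auto simp: ennreal_mult_top)
    then show ?thesis by (simp add: less_top)
  qed (simp add: ball_empty)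
  obtain t where t: "0 < t" "t < 1"
    "\<And>x r. 0 < r \<Longrightarrow> measure M (ball x r - ball x ((1 - t) * r)) \<le> (1 - \<epsilon>) / 2 * measure M (ball x r)"
    using thin_annulus[OF geo, of "(1 - \<epsilon>) / 2"] ed by auto
  have shrink: "ennreal \<delta> * emeasure N (ball x r) \<le> emeasure N (ball x ((1 - t) * r))" if r: "0 < r" for x r
  proof -
    have sub: "ball x ((1 - t) * r) \<subseteq> ball x r" 
      using t(1) r by (intro subset_ball) (simp add: algebra_simps)
    have "measure M (ball x r) - measure M (ball x ((1 - t) * r)) = measure M (ball x r - ball x ((1 - t) * r))"
      using sub less_imp_neq[OF ball_finite[of x r]] by (intro measure_Diff[symmetric]) auto
    also have "\<dots> \<le> (1 - \<epsilon>) / 2 * measure M (ball x r)" by (rule t(3)[OF r])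
    also have "\<dots> < (1 - \<epsilon>) * measure M (ball x r)" using ed measure_ball_pos[OF r, of x] by simp
    finally have "\<epsilon> * measure M (ball x r) < measure M (ball x ((1 - t) * r))" by (simp add: algebra_simps)
    then have "\<not> emeasure M (ball x ((1 - t) * r)) \<le> ennreal \<epsilon> * emeasure M (ball x r)"
      using ed by (simp add: emeasure_ball ennreal_mult[symmetric])
    then show ?thesis using A[OF r _ sub] by (auto simp: not_le[symmetric] intro: linear[THEN disjE])
  qed
  have shrink_power: "ennreal (\<delta> ^ n) * emeasure N (ball x r) \<le> emeasure N (ball x ((1 - t) ^ n * r))"
    if r: "0 < r" for x r n
  proof (induction n)
    case (Suc n)
    have "ennreal (\<delta> ^ Suc n) * emeasure N (ball x r) = ennreal \<delta> * (ennreal (\<delta> ^ n) * emeasure N (ball x r))"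
      using ed by (simp add: ennreal_mult mult.assoc)
    also have "\<dots> \<le> ennreal \<delta> * emeasure N (ball x ((1 - t) ^ n * r))"
      by (intro mult_left_mono Suc) auto
    also have "\<dots> \<le> emeasure N (ball x ((1 - t) * ((1 - t) ^ n * r)))"
      using t r by (intro shrink) auto
    finally show ?case by (simp add: mult.assoc)
  qed simp
  obtain n where n: "(1 - t) ^ n < 1/2" using real_arch_pow_inv[of "1/2" "1 - t"] t by auto
  have "doubling_radon N (1 / \<delta> ^ n)"
  proof
    fix x :: 'a and r :: real assume r: "0 < r"
    have "(1 - t) ^ n * (2 * r) \<le> 1/2 * (2 * r)" using n r by (intro mult_right_mono) auto
    then have "emeasure N (ball x ((1 - t) ^ n * (2 * r))) \<le> emeasure N (ball x r)"
      by (intro emeasure_mono subset_ball) (auto simp: sets_N)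
    with shrink_power[of "2 * r" n x] r
    have "ennreal (\<delta> ^ n) * emeasure N (ball x (2 * r)) \<le> emeasure N (ball x r)" by simp
    then have "ennreal (1 / \<delta> ^ n) * (ennreal (\<delta> ^ n) * emeasure N (ball x (2 * r)))
        \<le> ennreal (1 / \<delta> ^ n) * emeasure N (ball x r)" by (intro mult_left_mono) auto
    then show "emeasure N (ball x (2 * r)) \<le> ennreal (1 / \<delta> ^ n) * emeasure N (ball x r)"
      using ed by (simp add: mult.assoc[symmetric] ennreal_mult[symmetric] del: ennreal_power)
  qed (use radon_N pos fin in auto)
  then show thesis by (rule that)
qed

end

section \<open>The power law\<close>

text \<open>
  The situation reached by \<open>A_infinity_doubling\<close>, with the \<open>A\<^sub>\<infinity>\<close> condition stated for real-valued
  measures.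
\<close>

locale A_infinity_pair = M: doubling_radon M D + N: doubling_radon N K
  for M N :: "'a::polish_space measure" and D K :: real +
  fixes \<epsilon> \<delta> :: real
  assumes eps: "0 < \<epsilon>" "\<epsilon> < 1" and del: "0 < \<delta>" "\<delta> < 1"
    and small: "\<And>x r E. 0 < r \<Longrightarrow> E \<in> sets borel \<Longrightarrow> E \<subseteq> ball x r \<Longrightarrow>
        measure N E \<le> \<delta> * measure N (ball x r) \<Longrightarrow> measure M E \<le> \<epsilon> * measure M (ball x r)"
begin

text \<open>
  The factors by which one enlargement step changes the two measures. For \<open>M\<close>, the part of the enlarged
  set outside the old one has proportion at least \<open>(1 - \<epsilon>) / D\<^sup>2\<close>, where \<open>D\<^sup>2\<close> comes from the covering
  argument. For \<open>N\<close>, the covering argument costs \<open>K\<^sup>2\<close> and the choice of radii \<open>K / \<delta>\<close>.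
\<close>

definition "\<theta> = 1 - (1 - \<epsilon>) / D\<^sup>2"
definition "\<kappa> = K ^ 3 / \<delta>"

lemma theta: "0 < \<theta>" "\<theta> < 1"
proof -
  have "1 \<le> D\<^sup>2" using M.doubling_constant_ge_1 by simp
  then have "(1 - \<epsilon>) / D\<^sup>2 \<le> (1 - \<epsilon>) / 1" using eps by (intro divide_left_mono) auto
  then show "0 < \<theta>" unfolding \<theta>_def using eps by simp
  show "\<theta> < 1" unfolding \<theta>_def using eps M.doubling_constant_ge_1 by simp
qed

lemma kappa: "1 < \<kappa>" "K \<le> \<kappa>"
proof -
  have "1 \<le> K" by (rule N.doubling_constant_ge_1)
  then have "K ^ 1 \<le> K ^ 3" by (intro power_increasing) auto
  moreover have "\<delta> * K ^ 3 < 1 * K ^ 3" using del \<open>1 \<le> K\<close> by (intro mult_strict_right_mono) auto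
  then have "K ^ 3 < \<kappa>" unfolding \<kappa>_def using del by (simp add: pos_less_divide_eq mult.commute)
  ultimately show "1 < \<kappa>" "K \<le> \<kappa>" using \<open>1 \<le> K\<close> by auto
qed

text \<open>
  The radius at \<open>y \<in> E\<close> is found by halving \<open>\<rho>\<close> up to the last scale at which the \<open>N\<close>-density of
  \<open>E\<close> is still at most \<open>\<delta>\<close>; the process stops because \<open>E\<close> is open. By doubling the density at that
  scale is at least \<open>\<delta> / K\<close>. The upper bound feeds the \<open>A\<^sub>\<infinity>\<close> condition and controls \<open>M\<close>; the
  lower bound controls \<open>N\<close>.
\<close>

lemma enlargement_step:
  assumes E: "open E" "E \<subseteq> ball x R" and \<rho>: "0 < \<rho>"
    and sparse: "\<And>y. y \<in> E \<Longrightarrow> measure N E \<le> \<delta> * measure N (ball y \<rho>)"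
  obtains E' where "open E'" "E' \<subseteq> ball x (R + \<rho>)"
    "measure M E \<le> \<theta> * measure M E'" "measure N E' \<le> \<kappa> * measure N E"
proof -
  have E_sets: "E \<in> sets borel" using E(1) by (rule borel_open)
  have E_fm: "E \<in> fmeasurable M" "E \<in> fmeasurable N"
    using M.fmeasurable_in_ball[OF E_sets E(2)] N.fmeasurable_in_ball[OF E_sets E(2)] by auto
  have int_fm: "E \<inter> ball y s \<in> fmeasurable N" for y s
    using E_sets by (intro N.fmeasurable_in_ball[of _ y s]) auto
  have scale: "\<exists>r. 0 < r \<and> r \<le> \<rho> \<and> measure N (E \<inter> ball y r) \<le> \<delta> * measure N (ball y r) \<and>
      measure N (ball y r) \<le> K / \<delta> * measure N (E \<inter> ball y r)" if y: "y \<in> E" for y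
  proof -
    define P where "P i \<longleftrightarrow> \<delta> * measure N (ball y (\<rho> / 2 ^ i)) < measure N (E \<inter> ball y (\<rho> / 2 ^ i))" for i
    obtain e where e: "0 < e" "ball y e \<subseteq> E" using E(1) y open_contains_ball by blast
    obtain n where "(1/2::real) ^ n < e / \<rho>" using real_arch_pow_inv[of "e / \<rho>" "1/2"] e \<rho> by auto
    then have "\<rho> / 2 ^ n \<le> e" using \<rho> by (simp add: field_simps power_divide)
    then have "E \<inter> ball y (\<rho> / 2 ^ n) = ball y (\<rho> / 2 ^ n)" using e(2) subset_ball by blast
    moreover have "0 < measure N (ball y (\<rho> / 2 ^ n))" using \<rho> by (intro N.measure_ball_pos) auto
    ultimately have "P n" unfolding P_def using del by simp
    define i where "i = (LEAST i. P i)"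
    have Pi: "P i" unfolding i_def using \<open>P n\<close> by (rule LeastI)
    have "measure N (E \<inter> ball y \<rho>) \<le> measure N E"
      using E_fm E_sets by (intro measure_mono_fmeasurable) auto
    then have "\<not> P 0" unfolding P_def using sparse[OF y] by simp
    with Pi obtain j where j: "i = Suc j" by (cases i) auto
    have "\<not> P j" using not_less_Least[of j P] j i_def by auto
    let ?r = "\<rho> / 2 ^ j"
    have r: "0 < ?r" "?r \<le> \<rho>" using \<rho> by (auto simp: field_simps)
    have "measure N (ball y (2 * (?r / 2))) \<le> K * measure N (ball y (?r / 2))"
      using r by (intro N.measure_double) auto
    also have "measure N (ball y (?r / 2)) \<le> measure N (E \<inter> ball y (?r / 2)) / \<delta>"
      using Pi del unfolding P_def j by (simp add: field_simps)
    also have "measure N (E \<inter> ball y (?r / 2)) \<le> measure N (E \<inter> ball y ?r)"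
      using r E_sets by (intro measure_mono_fmeasurable int_fm) (auto simp: field_simps)
    finally have "measure N (ball y ?r) \<le> K / \<delta> * measure N (E \<inter> ball y ?r)"
      using del N.doubling_constant_ge_1 by (simp add: divide_right_mono mult_left_mono)
    with \<open>\<not> P j\<close> r show ?thesis unfolding P_def by (intro exI[of _ ?r]) auto
  qed
  then obtain r where r: "\<And>y. y \<in> E \<Longrightarrow> 0 < r y" "\<And>y. y \<in> E \<Longrightarrow> r y \<le> \<rho>"
    "\<And>y. y \<in> E \<Longrightarrow> measure N (E \<inter> ball y (r y)) \<le> \<delta> * measure N (ball y (r y))"
    "\<And>y. y \<in> E \<Longrightarrow> measure N (ball y (r y)) \<le> K / \<delta> * measure N (E \<inter> ball y (r y))"
    by metis
  define E' where "E' = (\<Union>y\<in>E. ball y (r y))"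
  have E'_open: "open E'" unfolding E'_def by auto
  then have E'_sets: "E' \<in> sets borel" by (rule borel_open)
  have sub: "E \<subseteq> E'" unfolding E'_def
  proof (intro subsetI UN_I)
    fix y assume "y \<in> E" then show "y \<in> ball y (r y)" using r(1) by simp
  qed
  have bounded: "E' \<subseteq> ball x (R + \<rho>)"
  proof
    fix w assume "w \<in> E'"
    then obtain y where y: "y \<in> E" "dist y w < r y" by (auto simp: E'_def)
    then have "dist x y < R" "dist y w < \<rho>" using E(2) r(2)[of y] by auto
    then show "w \<in> ball x (R + \<rho>)" using dist_triangle[of x w y] by simp
  qed
  have E'_fm: "E' \<in> fmeasurable M" using M.fmeasurable_in_ball[OF E'_sets bounded] .
  have "measure M E' \<le> D\<^sup>2 * (1 / (1 - \<epsilon>)) * measure M (- E \<inter> E')"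
    unfolding E'_def
  proof (rule M.vitali_restricted)
    fix y assume y: "y \<in> E"
    have "measure M (E \<inter> ball y (r y)) \<le> \<epsilon> * measure M (ball y (r y))"
      using r(1,3)[OF y] E_sets by (intro small) auto
    moreover have "- E \<inter> ball y (r y) = ball y (r y) - E \<inter> ball y (r y)" by auto
    then have "measure M (- E \<inter> ball y (r y)) = measure M (ball y (r y)) - measure M (E \<inter> ball y (r y))"
      using fmeasurableD2[OF M.ball_fmeasurable] E_sets by (simp add: measure_Diff)
    ultimately show "measure M (ball y (r y)) \<le> 1 / (1 - \<epsilon>) * measure M (- E \<inter> ball y (r y))"
      using eps by (simp add: field_simps)
  qed (use r(1) eps E_sets bounded in \<open>auto simp: E'_def\<close>)
  also have "- E \<inter> E' = E' - E" by auto
  also have "measure M (E' - E) = measure M E' - measure M E"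
    using fmeasurableD2[OF E'_fm] sub E_sets E'_sets by (intro measure_Diff) auto
  finally have "measure M E \<le> \<theta> * measure M E'"
    using eps M.doubling_constant_ge_1 by (simp add: \<theta>_def field_simps)
  moreover have "measure N E' \<le> K\<^sup>2 * (K / \<delta>) * measure N (E \<inter> E')"
    unfolding E'_def
    by (rule N.vitali_restricted) (use r(1,4) del N.doubling_constant_ge_1 E_sets bounded in \<open>auto simp: E'_def\<close>)
  then have "measure N E' \<le> \<kappa> * measure N E"
    using sub by (simp add: Int_absorb2 \<kappa>_def power3_eq_cube power2_eq_square)
  ultimately show thesis using that[of E'] E'_open bounded by auto
qed

text \<open>
  With \<open>i\<close> steps to go, the enlargement uses radii at most \<open>r * (1/2) ^ i\<close>. These add up to at most
  \<open>r\<close>, so all sets stay in \<open>ball x (2 * r)\<close>. The small radii are admissible because the bound on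
  \<open>measure N E\<close> shrinks like \<open>\<kappa> ^ i\<close>, while doubling makes the measures of the balls of these radii
  shrink at most like \<open>K ^ i \<le> \<kappa> ^ i\<close>.
\<close>

lemma open_power_decay:
  assumes r: "0 < r"
  shows "open E \<Longrightarrow> E \<subseteq> ball x (r * (1 + (1/2) ^ i)) \<Longrightarrow>
      \<kappa> ^ i * measure N E \<le> \<delta> / K\<^sup>2 * measure N (ball x r) \<Longrightarrow>
      measure M E \<le> \<theta> ^ i * measure M (ball x (2 * r))"
proof (induction i arbitrary: E)
  case 0
  then show ?case by (auto intro!: measure_mono_fmeasurable simp: mult.commute)
next
  case (Suc i)
  let ?\<rho> = "r * (1/2) ^ Suc i"
  have \<rho>: "0 < ?\<rho>" using r by simp
  have K: "1 \<le> K" by (rule N.doubling_constant_ge_1)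
  have "measure N E \<le> \<delta> * measure N (ball y ?\<rho>)" if y: "y \<in> E" for y
  proof -
    have "(1/2::real) ^ Suc i \<le> 1" by (rule power_le_one) auto
    then have "r * (1 + (1/2) ^ Suc i) \<le> r * (1 + 1)" using r by (intro mult_left_mono) auto
    then have "dist x y < 2 * r" using y Suc.prems(2) by auto
    \<comment> \<open>The two extra doublings account for \<open>ball x r \<subseteq> ball y (4 * r)\<close> and are paid for by the
      factor \<open>1 / K\<^sup>2\<close> in the hypothesis.\<close>
    have "ball x r \<subseteq> ball y (2 ^ (Suc i + 2) * ?\<rho>)"
    proof
      fix w assume "w \<in> ball x r"
      then have "dist y w < 4 * r"
        using \<open>dist x y < 2 * r\<close> dist_triangle[of y w x] r by (simp add: dist_commute)
      also have "4 * r = 2 ^ (Suc i + 2) * ?\<rho>" by (simp add: power_divide field_simps)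
      finally show "w \<in> ball y (2 ^ (Suc i + 2) * ?\<rho>)" by simp
    qed
    then have "measure N (ball x r) \<le> K ^ (Suc i + 2) * measure N (ball y ?\<rho>)"
      by (intro N.measure_ball_comparison \<rho>) auto
    then have "\<delta> / K\<^sup>2 * measure N (ball x r) \<le> \<delta> / K\<^sup>2 * (K ^ (Suc i + 2) * measure N (ball y ?\<rho>))"
      using del by (intro mult_left_mono) auto
    also have "K ^ (Suc i + 2) = K\<^sup>2 * K ^ Suc i" by (simp only: power_add mult.commute)
    also have "\<delta> / K\<^sup>2 * (K\<^sup>2 * K ^ Suc i * measure N (ball y ?\<rho>)) = K ^ Suc i * (\<delta> * measure N (ball y ?\<rho>))"
      using K by simp
    also have "\<dots> \<le> \<kappa> ^ Suc i * (\<delta> * measure N (ball y ?\<rho>))"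
      using K kappa del by (intro mult_right_mono power_mono) auto
    finally have "\<kappa> ^ Suc i * measure N E \<le> \<kappa> ^ Suc i * (\<delta> * measure N (ball y ?\<rho>))"
      using Suc.prems(3) by linarith
    then show ?thesis by (rule mult_left_le_imp_le) (use kappa in auto)
  qed
  from enlargement_step[OF Suc.prems(1,2) \<rho> this]
  obtain E' where E': "open E'" "E' \<subseteq> ball x (r * (1 + (1/2) ^ Suc i) + ?\<rho>)"
    "measure M E \<le> \<theta> * measure M E'" "measure N E' \<le> \<kappa> * measure N E" by blast
  have "r * (1 + (1/2) ^ Suc i) + ?\<rho> = r * (1 + (1/2) ^ i)" by (simp add: field_simps)
  moreover have "\<kappa> ^ i * measure N E' \<le> \<kappa> ^ i * (\<kappa> * measure N E)"
    using E'(4) kappa by (intro mult_left_mono) auto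
  then have "\<kappa> ^ i * measure N E' \<le> \<delta> / K\<^sup>2 * measure N (ball x r)"
    using Suc.prems(3) by (simp add: mult_ac)
  ultimately have "measure M E' \<le> \<theta> ^ i * measure M (ball x (2 * r))"
    using E' by (intro Suc.IH) auto
  then have "\<theta> * measure M E' \<le> \<theta> * (\<theta> ^ i * measure M (ball x (2 * r)))"
    using theta by (intro mult_left_mono) auto
  then show ?case using E'(3) by (simp add: mult.assoc)
qed

text \<open>
  The strict inequality leaves room to pass to an open superset by outer regularity of \<open>N\<close>.
\<close>

lemma borel_power_decay:
  assumes r: "0 < r" and E: "E \<in> sets borel" "E \<subseteq> ball x r"
    and le: "\<kappa> ^ i * measure N E < \<delta> / K\<^sup>2 * measure N (ball x r)"
  shows "measure M E \<le> D * \<theta> ^ i * measure M (ball x r)"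
proof -
  let ?b = "\<delta> / K\<^sup>2 * measure N (ball x r) / \<kappa> ^ i"
  have "0 < \<kappa> ^ i" using kappa by simp
  then have "measure N E < ?b" using le by (simp only: pos_less_divide_eq mult.commute[of "measure N E"])
  then have "ennreal (measure N E) < ennreal ?b" by (simp add: ennreal_less_iff)
  moreover have "E \<in> fmeasurable N" using N.fmeasurable_in_ball[OF E] .
  moreover have "emeasure N E = (INF U \<in> {U. E \<subseteq> U \<and> open U}. emeasure N U)"
    using N.radon E by (simp add: radon_measure_def)
  ultimately have "(INF U \<in> {U. E \<subseteq> U \<and> open U}. emeasure N U) < ennreal ?b"
    by (simp only: emeasure_eq_measure2)
  then obtain U where U: "E \<subseteq> U" "open U" "emeasure N U < ennreal ?b"
    by (auto simp: INF_less_iff)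
  let ?V = "U \<inter> ball x r"
  have V: "open ?V" "?V \<in> sets borel" using U by auto
  have V_fm: "?V \<in> fmeasurable N" "?V \<in> fmeasurable M"
    using N.fmeasurable_in_ball[OF V(2)] M.fmeasurable_in_ball[OF V(2)] by auto
  have "emeasure N ?V \<le> emeasure N U" using U by (intro emeasure_mono) auto
  also note U(3)
  finally have "measure N ?V < ?b" 
    using emeasure_eq_measure2[OF V_fm(1)] by (simp add: ennreal_less_iff)
  then have *: "\<kappa> ^ i * measure N ?V \<le> \<delta> / K\<^sup>2 * measure N (ball x r)"
    using \<open>0 < \<kappa> ^ i\<close> by (simp only: pos_less_divide_eq mult.commute[of "measure N ?V"] less_imp_le)
  have "ball x r \<subseteq> ball x (r * (1 + (1/2) ^ i))" using r by (intro subset_ball) simp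
  then have "measure M ?V \<le> \<theta> ^ i * measure M (ball x (2 * r))"
    by (intro open_power_decay r V *) auto
  also have "\<dots> \<le> \<theta> ^ i * (D * measure M (ball x r))"
    using theta r by (intro mult_left_mono M.measure_double) auto
  also have "measure M E \<le> measure M ?V"
    using U(1) E V_fm by (intro measure_mono_fmeasurable) auto
  finally show ?thesis by (simp add: mult_ac)
qed

text \<open>
  The factor \<open>\<delta> / K\<^sup>2\<close> is absorbed by giving up \<open>m\<close> steps of the iteration. As \<open>k\<close> varies this
  is the power law \<open>M(E)/M(B) \<le> C' (N(E)/N(B))\<^sup>\<alpha>\<close> with \<open>\<alpha> = log (1/\<theta>) / log \<kappa>\<close>.
\<close>

lemma power_decay:
  obtains C where "0 \<le> C"
    "\<And>x r E k. 0 < r \<Longrightarrow> E \<in> sets borel \<Longrightarrow> E \<subseteq> ball x r \<Longrightarrow>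
      \<kappa> ^ k * measure N E \<le> measure N (ball x r) \<Longrightarrow> measure M E \<le> C * \<theta> ^ k * measure M (ball x r)"
proof -
  have K: "1 \<le> K" and D: "1 \<le> D" by (rule N.doubling_constant_ge_1 M.doubling_constant_ge_1)+
  obtain m where "K\<^sup>2 / \<delta> < \<kappa> ^ m" using real_arch_pow kappa by blast
  then have m: "1 < \<kappa> ^ m * (\<delta> / K\<^sup>2)" using K del by (simp add: field_simps)
  show thesis
  proof (rule that[of "D / \<theta> ^ m"])
    show "0 \<le> D / \<theta> ^ m" using D theta by simp
    fix x :: 'a and r E k
    assume r: "0 < r" and E: "E \<in> sets borel" "E \<subseteq> ball x r"
      and le: "\<kappa> ^ k * measure N E \<le> measure N (ball x r)"
    show "measure M E \<le> D / \<theta> ^ m * \<theta> ^ k * measure M (ball x r)"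
    proof (cases "m \<le> k")
      case True
      then have k: "\<kappa> ^ k = \<kappa> ^ m * \<kappa> ^ (k - m)" "\<theta> ^ k = \<theta> ^ m * \<theta> ^ (k - m)"
        by (simp_all flip: power_add)
      have "\<kappa> ^ m * (\<kappa> ^ (k - m) * measure N E) \<le> 1 * measure N (ball x r)"
        using le by (simp add: k mult.assoc)
      also have "\<dots> < \<kappa> ^ m * (\<delta> / K\<^sup>2) * measure N (ball x r)"
        by (intro mult_strict_right_mono m N.measure_ball_pos r)
      finally have "\<kappa> ^ m * (\<kappa> ^ (k - m) * measure N E) < \<kappa> ^ m * (\<delta> / K\<^sup>2 * measure N (ball x r))"
        by (simp only: mult.assoc)
      then have "\<kappa> ^ (k - m) * measure N E < \<delta> / K\<^sup>2 * measure N (ball x r)"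
        by (rule mult_left_less_imp_less) (use kappa in simp)
      from borel_power_decay[OF r E this] show ?thesis using theta k by simp
    next
      case False
      have "measure M E \<le> 1 * 1 * measure M (ball x r)"
        using E by (simp add: measure_mono_fmeasurable)
      also have "\<dots> \<le> D * (\<theta> ^ k / \<theta> ^ m) * measure M (ball x r)"
        using D theta False by (intro mult_right_mono mult_mono) (auto simp: power_decreasing)
      finally show ?thesis by simp
    qed
  qed
qed

text \<open>
  By Chebyshev's inequality the set where \<open>h > l * b ^ k\<close> has \<open>N\<close>-proportion at most
  \<open>b ^ (- s * k)\<close>, which is at most \<open>\<kappa> ^ (- k)\<close> once \<open>s\<close> is large; so its \<open>M\<close>-proportion is at
  most \<open>C * \<theta> ^ k\<close>. The choice \<open>b = 1 / sqrt \<theta>\<close> makes the series for the integral of \<open>h\<close> converge.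
  The requirement \<open>2 \<le> s\<close> serves the integration of the maximal function in \<open>poincare_transfer\<close>.
\<close>

lemma average_transfer:
  obtains C s where "0 < C" "2 \<le> s"
    "\<And>x r h l. 0 < r \<Longrightarrow> h \<in> borel_measurable borel \<Longrightarrow> (\<And>y. 0 \<le> h y) \<Longrightarrow> 0 < l \<Longrightarrow>
      (\<integral>\<^sup>+y\<in>ball x r. ennreal (h y ^ s) \<partial>N) \<le> ennreal (l ^ s * measure N (ball x r)) \<Longrightarrow>
      (\<integral>\<^sup>+y\<in>ball x r. ennreal (h y) \<partial>M) \<le> ennreal (C * l * measure M (ball x r))"
proof -
  obtain C where C: "0 \<le> C"
    "\<And>x r E k. 0 < r \<Longrightarrow> E \<in> sets borel \<Longrightarrow> E \<subseteq> ball x r \<Longrightarrow>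
      \<kappa> ^ k * measure N E \<le> measure N (ball x r) \<Longrightarrow> measure M E \<le> C * \<theta> ^ k * measure M (ball x r)"
    using power_decay by blast
  define b where "b = 1 / sqrt \<theta>"
  have b: "1 < b" "b * \<theta> = sqrt \<theta>" "sqrt \<theta> < 1"
    using theta by (auto simp: b_def real_div_sqrt)
  obtain s0 where s0: "\<kappa> < b ^ s0" using real_arch_pow b(1) by blast
  define s where "s = s0 + 2"
  have "b ^ s0 \<le> b ^ s" unfolding s_def using b by (intro power_increasing) auto
  then have s: "\<kappa> \<le> b ^ s" "2 \<le> s" using s0 by (auto simp: s_def)
  show thesis
  proof (rule that[of "1 + C * b / (1 - sqrt \<theta>)" s])
    show "0 < 1 + C * b / (1 - sqrt \<theta>)" using C(1) b by (intro add_pos_nonneg) auto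
    show "2 \<le> s" by fact
    fix x :: 'a and r :: real and h :: "'a \<Rightarrow> real" and l :: real
    assume r: "0 < r" and h[measurable]: "h \<in> borel_measurable borel" and h0: "\<And>y. 0 \<le> h y" and l: "0 < l"
      and int: "(\<integral>\<^sup>+y\<in>ball x r. ennreal (h y ^ s) \<partial>N) \<le> ennreal (l ^ s * measure N (ball x r))"
    let ?B = "ball x r"
    have "(\<integral>\<^sup>+y\<in>?B. ennreal (h y) \<partial>M)
        \<le> ennreal (l * (measure M ?B + C * measure M ?B * b / (1 - b * \<theta>)))"
    proof (rule layer_cake_geometric)
      fix k
      let ?E = "{y \<in> ?B. l * b ^ k < h y}"
      have "?E = ?B \<inter> {y. l * b ^ k < h y}" by auto
      then have E: "?E \<in> sets borel" by simp
      have E_fm: "?E \<in> fmeasurable N" using E by (rule N.fmeasurable_in_ball) auto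
      have "ennreal (l ^ s * (\<kappa> ^ k * measure N ?E)) \<le> ennreal ((l * b ^ k) ^ s * measure N ?E)"
      proof (rule ennreal_leI)
        have "\<kappa> ^ k \<le> (b ^ s) ^ k" using s kappa by (intro power_mono) auto
        then have "l ^ s * (\<kappa> ^ k * measure N ?E) \<le> l ^ s * ((b ^ s) ^ k * measure N ?E)"
          using l by (intro mult_left_mono mult_right_mono) auto
        then show "l ^ s * (\<kappa> ^ k * measure N ?E) \<le> (l * b ^ k) ^ s * measure N ?E"
          by (simp add: power_mult_distrib mult.commute flip: power_mult)
      qed
      also have "\<dots> = (\<integral>\<^sup>+y. ennreal ((l * b ^ k) ^ s) * indicator ?E y \<partial>N)"
        using E l b emeasure_eq_measure2[OF E_fm]
        by (simp add: nn_integral_cmult_indicator ennreal_mult)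
      also have "\<dots> \<le> (\<integral>\<^sup>+y\<in>?B. ennreal (h y ^ s) \<partial>N)"
        using l b by (intro nn_integral_mono) (auto split: split_indicator intro!: ennreal_leI power_mono)
      also note int
      finally have "\<kappa> ^ k * measure N ?E \<le> measure N ?B"
        using l by (simp add: ennreal_le_iff)
      then have "measure M ?E \<le> C * \<theta> ^ k * measure M ?B" by (intro C(2) r E) auto
      then show "measure M ?E \<le> C * measure M ?B * \<theta> ^ k" by (simp add: mult_ac)
    qed (use b theta l C in auto)
    then show "(\<integral>\<^sup>+y\<in>?B. ennreal (h y) \<partial>M) \<le> ennreal ((1 + C * b / (1 - sqrt \<theta>)) * l * measure M ?B)"
      using b by (simp add: algebra_simps)
  qed
qed

end

section \<open>Measurability of the lower Lipschitz constant\<close>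

definition oscillation_quotient :: "('a::metric_space \<Rightarrow> real) \<Rightarrow> 'a \<Rightarrow> real \<Rightarrow> ennreal" where
  "oscillation_quotient f x r = (SUP y \<in> ball x r. ennreal (\<bar>f x - f y\<bar> / r))"

lemma oscillation_quotient_le:
  assumes f: "L-lipschitz_on UNIV f" and r: "0 < r"
  shows "oscillation_quotient f x r \<le> ennreal L"
  unfolding oscillation_quotient_def
proof (intro SUP_least ennreal_leI)
  fix y assume y: "y \<in> ball x r"
  have L: "0 \<le> L" using f by (rule lipschitz_on_nonneg)
  have "\<bar>f x - f y\<bar> \<le> L * dist x y" using lipschitz_onD[OF f, of x y] by (simp add: dist_real_def)
  also have "\<dots> \<le> L * r" using y L by (intro mult_left_mono) auto
  finally show "\<bar>f x - f y\<bar> / r \<le> L" using r by (simp add: pos_divide_le_eq)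
qed

lemma oscillation_quotient_rescale:
  assumes "0 < s" "s \<le> r"
  shows "oscillation_quotient f x s \<le> ennreal (r / s) * oscillation_quotient f x r"
  unfolding oscillation_quotient_def
proof (rule SUP_least)
  fix y assume y: "y \<in> ball x s"
  have "ennreal (\<bar>f x - f y\<bar> / s) = ennreal (r / s) * ennreal (\<bar>f x - f y\<bar> / r)"
    using assms by (simp add: ennreal_mult[symmetric])
  also have "\<dots> \<le> ennreal (r / s) * (SUP y \<in> ball x r. ennreal (\<bar>f x - f y\<bar> / r))"
    using y assms by (intro mult_left_mono SUP_upper) auto
  finally show "ennreal (\<bar>f x - f y\<bar> / s) \<le> ennreal (r / s) * (SUP y \<in> ball x r. ennreal (\<bar>f x - f y\<bar> / r))" .
qed

text \<open>
  Lower semicontinuity: as balls are open, \<open>y \<in> ball x r\<close> and a strict lower bound on the quotient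
  persist when \<open>x\<close> moves a little.
\<close>

lemma oscillation_quotient_measurable [measurable]:
  assumes f: "continuous_on UNIV f"
  shows "(\<lambda>x. oscillation_quotient f x r) \<in> borel_measurable borel"
proof (rule borel_measurableI_greater)
  fix a :: ennreal
  have "{x \<in> space borel. a < oscillation_quotient f x r}
      = (\<Union>y. {x. dist x y < r} \<inter> {x. a < ennreal (\<bar>f x - f y\<bar> / r)})"
    by (auto simp: oscillation_quotient_def less_SUP_iff)
  also have "open \<dots>"
    using f unfolding divide_inverse by (intro open_UN ballI open_Int open_Collect_less continuous_intros continuous_on_ennreal) auto
  finally show "{x \<in> space borel. a < oscillation_quotient f x r} \<in> sets borel" by simp
qed

lemma lower_lip_le:
  assumes f: "L-lipschitz_on UNIV f"
  shows "lower_lip f x \<le> ennreal L"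
proof -
  have "eventually (\<lambda>r. oscillation_quotient f x r \<le> ennreal L) (at_right 0)"
    using eventually_at_right_less[of 0] by eventually_elim (rule oscillation_quotient_le[OF f])
  then show ?thesis unfolding lower_lip_def oscillation_quotient_def by (intro Liminf_le) auto
qed

text \<open>
  Shrinking the radius from \<open>r\<close> to a rational \<open>s\<close> multiplies the quotient by at most \<open>r / s\<close>, and this
  is arbitrarily close to \<open>1\<close>. So a lower bound for all rational radii is one for all radii.
\<close>

lemma lower_lip_rational_radii:
  assumes f: "L-lipschitz_on UNIV f"
  shows "lower_lip f x = (SUP n. INF r \<in> {r. r \<in> \<rat> \<and> 0 < r \<and> r < 1 / real (Suc n)}. oscillation_quotient f x r)"
    (is "_ = (SUP n. ?I n)")
proof (rule antisym)
  show "lower_lip f x \<le> (SUP n. ?I n)"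
    unfolding lower_lip_def oscillation_quotient_def[symmetric]
  proof (rule Liminf_least)
    fix P :: "real \<Rightarrow> bool" assume "eventually P (at_right 0)"
    then obtain b where b: "0 < b" "\<And>r. 0 < r \<Longrightarrow> r < b \<Longrightarrow> P r"
      unfolding eventually_at_right_field by auto
    obtain n where "inverse (real (Suc n)) < b" using reals_Archimedean b(1) by blast
    then have "{r. r \<in> \<rat> \<and> 0 < r \<and> r < 1 / real (Suc n)} \<subseteq> Collect P"
      using b(2) by (auto simp: inverse_eq_divide)
    then have "(INF r\<in>Collect P. oscillation_quotient f x r) \<le> ?I n" by (rule INF_superset_mono) simp
    also have "\<dots> \<le> (SUP n. ?I n)" by (rule SUP_upper) simp
    finally show "(INF r\<in>Collect P. oscillation_quotient f x r) \<le> (SUP n. ?I n)" .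
  qed
next
  show "(SUP n. ?I n) \<le> lower_lip f x"
  proof (rule SUP_least)
    fix n :: nat
    have "?I n \<le> oscillation_quotient f x r" if r: "0 < r" "r < 1 / real (Suc n)" for r
    proof (rule ccontr)
      assume "\<not> ?thesis"
      then have less: "oscillation_quotient f x r < ?I n" by simp
      have le: "?I n \<le> ennreal (r / s) * oscillation_quotient f x r" if s: "s \<in> \<rat>" "0 < s" "s < r" for s
      proof -
        have "?I n \<le> oscillation_quotient f x s" using s r by (intro INF_lower) auto
        also have "\<dots> \<le> ennreal (r / s) * oscillation_quotient f x r"
          using s by (intro oscillation_quotient_rescale) auto
        finally show ?thesis .
      qed
      obtain a where a: "0 \<le> a" "oscillation_quotient f x r = ennreal a"
        using oscillation_quotient_le[OF f r(1), of x] by (cases "oscillation_quotient f x r") (auto simp: top_unique)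
      obtain s0 where s0: "s0 \<in> \<rat>" "0 < s0" "s0 < r" using Rats_dense_in_real[OF r(1)] by auto
      obtain b where b: "0 \<le> b" "?I n = ennreal b"
        using le[OF s0] s0 by (cases "?I n") (auto simp: a ennreal_mult[symmetric] top_unique)
      have ab: "a < b" using less a b by (simp add: ennreal_less_iff)
      \<comment> \<open>Any rational \<open>s\<close> with \<open>r * a / b < s < r\<close> has \<open>(r / s) * a < b\<close>, contrary to \<open>le\<close>.\<close>
      then have "r * a / b < r" using r a by (simp add: field_simps)
      then obtain s where s: "s \<in> \<rat>" "max (r * a / b) 0 < s" "s < r"
        using Rats_dense_in_real[of "max (r * a / b) 0" r] r by auto
      then have "0 < s" by simp
      have "ennreal b \<le> ennreal (r / s) * ennreal a" using le[OF s(1) \<open>0 < s\<close> s(3)] by (simp only: a b)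
      also have "\<dots> = ennreal (r / s * a)" using \<open>0 < s\<close> r a by (subst ennreal_mult[symmetric]) auto
      finally have "b \<le> r / s * a" using \<open>0 < s\<close> r a by (subst (asm) ennreal_le_iff) auto
      then have "s * b \<le> r * a" using s by (simp add: field_simps)
      moreover have "r * a < s * b" using s ab a by (simp add: field_simps)
      ultimately show False by simp
    qed
    then have "?I n \<le> (INF r\<in>{r. 0 < r \<and> r < 1 / real (Suc n)}. oscillation_quotient f x r)"
      by (intro INF_greatest) auto
    also have "\<dots> \<le> lower_lip f x"
      unfolding lower_lip_def oscillation_quotient_def[symmetric] Liminf_def
    proof (rule SUP_upper2[of "\<lambda>r. 0 < r \<and> r < 1 / real (Suc n)"])
      show "(\<lambda>r. 0 < r \<and> r < 1 / real (Suc n)) \<in> {P. eventually P (at_right 0)}"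
        unfolding mem_Collect_eq eventually_at_right_field by (intro exI[of _ "1 / real (Suc n)"]) auto
    qed simp
    finally show "?I n \<le> lower_lip f x" .
  qed
qed

lemma lower_lip_measurable:
  assumes f: "L-lipschitz_on UNIV f"
  shows "lower_lip f \<in> borel_measurable borel"
proof -
  have cont: "continuous_on UNIV f" using f by (rule lipschitz_on_continuous_on)
  have "countable {r::real. r \<in> \<rat> \<and> 0 < r \<and> r < 1 / real (Suc n)}" for n
    by (rule countable_subset[OF _ countable_rat]) auto
  then have "(\<lambda>x. SUP n. INF r \<in> {r. r \<in> \<rat> \<and> 0 < r \<and> r < 1 / real (Suc n)}. oscillation_quotient f x r)
      \<in> borel_measurable borel"
    by (intro borel_measurable_SUP borel_measurable_INF oscillation_quotient_measurable cont) auto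
  then show ?thesis by (subst lower_lip_rational_radii[OF f, abs_def]) 
qed

section \<open>Mean values and telescoping\<close>

lemma mean_value_nonneg: "(\<And>y. 0 \<le> u y) \<Longrightarrow> 0 \<le> mean_value M A u"
  unfolding mean_value_def set_lebesgue_integral_def
  by (intro divide_nonneg_nonneg Bochner_Integration.integral_nonneg) auto

lemma lipschitz_deviation_bounded:
  assumes f: "L-lipschitz_on UNIV f" and y: "y \<in> ball x r"
  shows "\<bar>f y - c\<bar> \<le> L * r + \<bar>f x - c\<bar>"
proof -
  have "\<bar>f y - f x\<bar> \<le> L * dist y x" using lipschitz_onD[OF f, of y x] by (simp add: dist_real_def)
  also have "\<dots> \<le> L * r" using y lipschitz_on_nonneg[OF f] by (intro mult_left_mono) (auto simp: dist_commute)
  finally show ?thesis by linarith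
qed

context doubling_radon
begin

lemma set_integrable_ball:
  fixes u :: "'a \<Rightarrow> real"
  assumes u: "u \<in> borel_measurable borel" and b: "\<And>y. y \<in> ball x r \<Longrightarrow> \<bar>u y\<bar> \<le> b"
  shows "set_integrable M (ball x r) u"
  unfolding set_integrable_def
proof (rule Bochner_Integration.integrable_bound)
  show "integrable M (\<lambda>y. b * indicator (ball x r) y)"
    using ball_finite by (intro integrable_mult_right integrable_real_indicator) auto
  have "(\<lambda>y. indicator (ball x r) y *\<^sub>R u y) \<in> borel_measurable borel"
    by (intro borel_measurable_scaleR borel_measurable_indicator u) simp
  then show "(\<lambda>y. indicator (ball x r) y *\<^sub>R u y) \<in> borel_measurable M" by simp
  show "AE y in M. norm (indicator (ball x r) y *\<^sub>R u y) \<le> norm (b * indicator (ball x r) y)"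
  proof (intro AE_I2)
    fix y show "norm (indicator (ball x r) y *\<^sub>R u y) \<le> norm (b * indicator (ball x r) y)"
      using b[of y] by (auto split: split_indicator)
  qed
qed

lemma nn_integral_eq_mean_value:
  fixes u :: "'a \<Rightarrow> real"
  assumes r: "0 < r" and u: "u \<in> borel_measurable borel" "\<And>y. 0 \<le> u y" "\<And>y. y \<in> ball x r \<Longrightarrow> u y \<le> b"
  shows "(\<integral>\<^sup>+y\<in>ball x r. ennreal (u y) \<partial>M) = ennreal (mean_value M (ball x r) u * measure M (ball x r))"
proof -
  have "set_integrable M (ball x r) u" using u by (intro set_integrable_ball[of u x r b]) auto
  then have "(\<integral>\<^sup>+y. ennreal (indicator (ball x r) y *\<^sub>R u y) \<partial>M) = ennreal (LINT y:ball x r|M. u y)"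
    using u(2) unfolding set_integrable_def set_lebesgue_integral_def
    by (intro nn_integral_eq_integral) auto
  moreover have "(\<integral>\<^sup>+y. ennreal (indicator (ball x r) y *\<^sub>R u y) \<partial>M) = (\<integral>\<^sup>+y\<in>ball x r. ennreal (u y) \<partial>M)"
    by (intro nn_integral_cong) (auto split: split_indicator)
  moreover have "(LINT y:ball x r|M. u y) = mean_value M (ball x r) u * measure M (ball x r)"
    using measure_ball_pos[OF r, of x] by (simp add: mean_value_def)
  ultimately show ?thesis by simp
qed

lemma mean_value_le_iff:
  fixes u :: "'a \<Rightarrow> real"
  assumes r: "0 < r" and u: "u \<in> borel_measurable borel" "\<And>y. 0 \<le> u y" "\<And>y. y \<in> ball x r \<Longrightarrow> u y \<le> b"
    and c: "0 \<le> c"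
  shows "(\<integral>\<^sup>+y\<in>ball x r. ennreal (u y) \<partial>M) \<le> ennreal (c * measure M (ball x r)) \<longleftrightarrow>
    mean_value M (ball x r) u \<le> c"
  using nn_integral_eq_mean_value[OF r u] measure_ball_pos[OF r, of x] c mean_value_nonneg[OF u(2), of M "ball x r"]
  by (simp add: ennreal_le_iff)

lemma mean_value_deviation:
  assumes f: "L-lipschitz_on UNIV f" and s: "0 < s" and sub: "ball x s \<subseteq> ball y r"
    and k: "0 \<le> k" "measure M (ball y r) \<le> k * measure M (ball x s)"
  shows "\<bar>mean_value M (ball x s) f - c\<bar> \<le> k * mean_value M (ball y r) (\<lambda>z. \<bar>f z - c\<bar>)"
proof -
  have r: "0 < r" using sub s by (metis ball_eq_empty centre_in_ball empty_iff not_le subsetD)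
  have fm[measurable]: "f \<in> borel_measurable borel"
    using lipschitz_on_continuous_on[OF f] by (rule borel_measurable_continuous_onI)
  have int: "set_integrable M (ball z t) (\<lambda>z. f z - d)" for z t d
    by (rule set_integrable_ball[where b = "L * t + \<bar>f z - d\<bar>"]) (auto intro!: lipschitz_deviation_bounded[OF f])
  have int_abs: "set_integrable M (ball z t) (\<lambda>z. \<bar>f z - c\<bar>)" for z t
    using set_integrable_abs[OF int] .
  have pos: "0 < measure M (ball x s)" "0 < measure M (ball y r)" using s r measure_ball_pos by auto
  have f_int: "set_integrable M (ball x s) f" using int[of x s 0] by simp
  have c_int: "set_integrable M (ball x s) (\<lambda>z. c)" by (rule set_integrable_ball[where b = "\<bar>c\<bar>"]) auto
  have "(LINT z:ball x s|M. f z - c) = (LINT z:ball x s|M. f z) - (LINT z:ball x s|M. c)"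
    by (rule set_integral_diff(2)[OF f_int c_int])
  also have "(LINT z:ball x s|M. c) = measure M (ball x s) * c"
    by (simp add: set_lebesgue_integral_def)
  finally have "mean_value M (ball x s) f - c = (LINT z:ball x s|M. f z - c) / measure M (ball x s)"
    using pos by (simp add: mean_value_def field_simps)
  then have "\<bar>mean_value M (ball x s) f - c\<bar> = \<bar>LINT z:ball x s|M. f z - c\<bar> / measure M (ball x s)"
    using pos by simp
  also have "\<bar>LINT z:ball x s|M. f z - c\<bar> \<le> (LINT z:ball x s|M. \<bar>f z - c\<bar>)"
    using set_integral_norm_bound[OF int[of x s c]] by simp
  also have "\<dots> \<le> (LINT z:ball y r|M. \<bar>f z - c\<bar>)"
    unfolding set_lebesgue_integral_def
    using sub int_abs[unfolded set_integrable_def]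
    by (intro integral_mono) (auto split: split_indicator)
  finally have "\<bar>mean_value M (ball x s) f - c\<bar> \<le> (LINT z:ball y r|M. \<bar>f z - c\<bar>) / measure M (ball x s)"
    using pos by (simp add: divide_right_mono)
  also have "\<dots> = mean_value M (ball y r) (\<lambda>z. \<bar>f z - c\<bar>) * (measure M (ball y r) / measure M (ball x s))"
    using pos by (simp add: mean_value_def)
  also have "\<dots> \<le> mean_value M (ball y r) (\<lambda>z. \<bar>f z - c\<bar>) * k"
    using pos k by (intro mult_left_mono mean_value_nonneg) (auto simp: pos_divide_le_eq)
  finally show ?thesis by (simp add: mult.commute)
qed

text \<open>
  The mean is, up to a factor of two, the best constant. This allows the \<open>M\<close>-mean to be used as the
  centre in an average with respect to another measure.
\<close>

lemma mean_value_recenter: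
  assumes f: "L-lipschitz_on UNIV f" and r: "0 < r"
  shows "mean_value M (ball x r) (\<lambda>y. \<bar>f y - mean_value M (ball x r) f\<bar>)
    \<le> 2 * mean_value M (ball x r) (\<lambda>y. \<bar>f y - c\<bar>)"
proof -
  let ?B = "ball x r" and ?m = "mean_value M (ball x r) f"
  have fm[measurable]: "f \<in> borel_measurable borel"
    using lipschitz_on_continuous_on[OF f] by (rule borel_measurable_continuous_onI)
  have int: "set_integrable M ?B (\<lambda>z. \<bar>f z - d\<bar>)" for d
    by (intro set_integrable_abs set_integrable_ball[where b = "L * r + \<bar>f x - d\<bar>"])
       (auto intro!: lipschitz_deviation_bounded[OF f])
  have pos: "0 < measure M ?B" by (rule measure_ball_pos[OF r])
  have c_int: "set_integrable M ?B (\<lambda>z. \<bar>c - ?m\<bar>)" by (rule set_integrable_ball[where b = "\<bar>c - ?m\<bar>"]) auto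
  have "(LINT z:?B|M. \<bar>f z - ?m\<bar>) \<le> (LINT z:?B|M. \<bar>f z - c\<bar> + \<bar>c - ?m\<bar>)"
    by (intro set_integral_mono int set_integral_add c_int) auto
  also have "\<dots> = (LINT z:?B|M. \<bar>f z - c\<bar>) + (LINT z:?B|M. \<bar>c - ?m\<bar>)"
    by (intro set_integral_add int c_int)
  also have "(LINT z:?B|M. \<bar>c - ?m\<bar>) = measure M ?B * \<bar>c - ?m\<bar>"
    by (simp add: set_lebesgue_integral_def)
  finally have "mean_value M ?B (\<lambda>z. \<bar>f z - ?m\<bar>) \<le> mean_value M ?B (\<lambda>z. \<bar>f z - c\<bar>) + \<bar>c - ?m\<bar>"
    using pos unfolding mean_value_def by (simp add: field_simps)
  moreover have "\<bar>?m - c\<bar> \<le> 1 * mean_value M ?B (\<lambda>z. \<bar>f z - c\<bar>)"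
    by (rule mean_value_deviation[OF f r]) auto
  ultimately show ?thesis by (simp add: abs_minus_commute)
qed

text \<open>
  Pass from the mean over \<open>ball x r\<close> to that over \<open>ball y (2 * r)\<close> and then halve the radius
  repeatedly. Each comparison costs a factor of at most \<open>D\<^sup>2\<close>, the first one \<open>2 * D\<^sup>2 * T * r\<close> in
  total and the others at most twice that; the means converge to \<open>f y\<close> by Lipschitz continuity.
\<close>

lemma telescoping:
  assumes f: "L-lipschitz_on UNIV f" and r: "0 < r" and y: "y \<in> ball x r"
    and osc: "\<And>\<rho>. 0 < \<rho> \<Longrightarrow> \<rho> \<le> 2 * r \<Longrightarrow>
      mean_value M (ball y \<rho>) (\<lambda>z. \<bar>f z - mean_value M (ball y \<rho>) f\<bar>) \<le> T * \<rho>"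
  shows "\<bar>f y - mean_value M (ball x r) f\<bar> \<le> 6 * D\<^sup>2 * T * r"
proof -
  define \<rho> where "\<rho> n = 2 * r / 2 ^ n" for n :: nat
  define a where "a n = mean_value M (ball y (\<rho> n)) f" for n
  have \<rho>: "0 < \<rho> n" "\<rho> n \<le> 2 * r" for n using r by (auto simp: \<rho>_def field_simps)
  have osc_n: "mean_value M (ball y (\<rho> n)) (\<lambda>z. \<bar>f z - a n\<bar>) \<le> T * \<rho> n" for n
    unfolding a_def by (intro osc \<rho>)
  have D: "1 \<le> D" "D \<le> D\<^sup>2" using doubling_constant_ge_1 by (auto simp: power2_eq_square)
  have start: "\<bar>mean_value M (ball x r) f - a 0\<bar> \<le> D\<^sup>2 * T * (2 * r)"
  proof -
    have "ball y (2 * r) \<subseteq> ball x (2 ^ 2 * r)"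
    proof
      fix w assume "w \<in> ball y (2 * r)"
      then show "w \<in> ball x (2 ^ 2 * r)" using y dist_triangle[of x w y] r by simp
    qed
    then have "measure M (ball y (2 * r)) \<le> D\<^sup>2 * measure M (ball x r)"
      using r by (intro measure_ball_comparison) auto
    moreover have "ball x r \<subseteq> ball y (2 * r)"
    proof
      fix w assume "w \<in> ball x r"
      then show "w \<in> ball y (2 * r)" using y dist_triangle[of y w x] by (simp add: dist_commute)
    qed
    ultimately have "\<bar>mean_value M (ball x r) f - a 0\<bar> \<le> D\<^sup>2 * mean_value M (ball y (2 * r)) (\<lambda>z. \<bar>f z - a 0\<bar>)"
      by (intro mean_value_deviation[OF f r]) auto
    also have "\<dots> \<le> D\<^sup>2 * (T * (2 * r))"
      using osc_n[of 0] by (intro mult_left_mono) (auto simp: \<rho>_def)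
    finally show ?thesis by (simp add: mult.assoc)
  qed
  have step: "\<bar>a (Suc n) - a n\<bar> \<le> D\<^sup>2 * T * (2 * r) * (1/2) ^ n" for n
  proof -
    have two: "\<rho> n = 2 * \<rho> (Suc n)" by (simp add: \<rho>_def)
    have "measure M (ball y (\<rho> n)) \<le> D * measure M (ball y (\<rho> (Suc n)))"
      unfolding two by (intro measure_double \<rho>)
    also have "\<dots> \<le> D\<^sup>2 * measure M (ball y (\<rho> (Suc n)))" using D by (intro mult_right_mono) auto
    finally have "\<bar>a (Suc n) - a n\<bar> \<le> D\<^sup>2 * mean_value M (ball y (\<rho> n)) (\<lambda>z. \<bar>f z - a n\<bar>)"
      unfolding a_def[of "Suc n"] using \<rho>[of "Suc n"] two
      by (intro mean_value_deviation[OF f \<rho>(1)] subset_ball) auto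
    also have "\<dots> \<le> D\<^sup>2 * (T * \<rho> n)" using osc_n[of n] by (intro mult_left_mono) auto
    finally show ?thesis by (simp add: \<rho>_def power_divide mult.assoc)
  qed
  have partial: "\<bar>mean_value M (ball x r) f - a n\<bar> \<le> D\<^sup>2 * T * (2 * r) * (3 - 2 * (1/2) ^ n)" for n
  proof (induction n)
    case 0
    then show ?case using start by simp
  next
    case (Suc n)
    have "D\<^sup>2 * T * (2 * r) * (3 - 2 * (1/2) ^ n) + D\<^sup>2 * T * (2 * r) * (1/2) ^ n
        = D\<^sup>2 * T * (2 * r) * (3 - 2 * (1/2) ^ Suc n)" by (simp add: algebra_simps)
    then show ?case using Suc step[of n] by linarith
  qed
  have "0 \<le> T * \<rho> 0" by (rule order_trans[OF mean_value_nonneg osc_n[of 0]]) simp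
  then have T: "0 \<le> T" using \<rho>[of 0] by (simp add: zero_le_mult_iff)
  have bound: "\<bar>mean_value M (ball x r) f - a n\<bar> \<le> 6 * D\<^sup>2 * T * r" for n
  proof -
    have "D\<^sup>2 * T * (2 * r) * (3 - 2 * (1/2) ^ n) \<le> D\<^sup>2 * T * (2 * r) * 3"
      using T r by (intro mult_left_mono) auto
    then show ?thesis using partial[of n] by (simp add: mult_ac)
  qed
  have close: "\<bar>a n - f y\<bar> \<le> L * \<rho> n" for n
  proof -
    have fm[measurable]: "f \<in> borel_measurable borel"
      using lipschitz_on_continuous_on[OF f] by (rule borel_measurable_continuous_onI)
    have dev: "\<bar>f z - f y\<bar> \<le> L * \<rho> n" if "z \<in> ball y (\<rho> n)" for z
      using lipschitz_deviation_bounded[OF f that, of "f y"] by simp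
    have "\<bar>a n - f y\<bar> \<le> 1 * mean_value M (ball y (\<rho> n)) (\<lambda>z. \<bar>f z - f y\<bar>)"
      unfolding a_def by (intro mean_value_deviation[OF f \<rho>(1)]) auto
    also have "mean_value M (ball y (\<rho> n)) (\<lambda>z. \<bar>f z - f y\<bar>) \<le> L * \<rho> n"
    proof (subst mean_value_le_iff[symmetric])
      have "(\<integral>\<^sup>+z\<in>ball y (\<rho> n). ennreal \<bar>f z - f y\<bar> \<partial>M) \<le> (\<integral>\<^sup>+z. ennreal (L * \<rho> n) * indicator (ball y (\<rho> n)) z \<partial>M)"
        using dev by (intro nn_integral_mono) (auto split: split_indicator intro!: ennreal_leI)
      also have "\<dots> = ennreal (L * \<rho> n * measure M (ball y (\<rho> n)))"
        using lipschitz_on_nonneg[OF f] \<rho>[of n]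
        by (subst nn_integral_cmult_indicator) (auto simp: emeasure_ball ennreal_mult)
      finally show "(\<integral>\<^sup>+z\<in>ball y (\<rho> n). ennreal \<bar>f z - f y\<bar> \<partial>M) \<le> ennreal (L * \<rho> n * measure M (ball y (\<rho> n)))" .
    qed (use dev \<rho>[of n] lipschitz_on_nonneg[OF f] in auto)
    finally show ?thesis by simp
  qed
  have "(\<lambda>n. L * \<rho> n) \<longlonglongrightarrow> 0"
  proof -
    have "(\<lambda>n. L * (2 * r) * (1/2) ^ n) \<longlonglongrightarrow> L * (2 * r) * 0"
      by (intro tendsto_mult tendsto_const LIMSEQ_power_zero) auto
    then show ?thesis by (simp add: \<rho>_def power_divide)
  qed
  then have "a \<longlonglongrightarrow> f y"
    by (rule LIM_zero_cancel[OF Lim_null_comparison[rotated]]) (use close in auto)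
  then have "(\<lambda>n. \<bar>mean_value M (ball x r) f - a n\<bar>) \<longlonglongrightarrow> \<bar>mean_value M (ball x r) f - f y\<bar>"
    by (intro tendsto_intros)
  then have "\<bar>mean_value M (ball x r) f - f y\<bar> \<le> 6 * D\<^sup>2 * T * r"
    by (rule LIMSEQ_le_const2) (use bound in auto)
  then show ?thesis by (simp add: abs_minus_commute)
qed

section \<open>The maximal function and the inequality for the second measure\<close>

text \<open>
  The weak type inequality for the maximal function of \<open>G\<close> at level \<open>\<tau>\<close>, with \<open>vitali_transfer\<close>
  applied to the measure of density \<open>G\<close>. The open set \<open>U\<close> stands in for the level set, whose
  measurability is then not an issue.
\<close>

lemma maximal_weak_type:
  assumes G[measurable]: "G \<in> borel_measurable borel" and \<tau>: "0 < \<tau>" and S: "S \<subseteq> ball x r"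
    and large: "\<And>y. y \<in> S \<Longrightarrow> \<exists>\<rho>. 0 < \<rho> \<and> \<rho> \<le> R \<and>
        ennreal (\<tau> * measure M (ball y \<rho>)) \<le> (\<integral>\<^sup>+z\<in>ball y \<rho>. G z \<partial>M)"
  obtains U where "open U" "S \<subseteq> U" "U \<subseteq> ball x (r + R)"
    "ennreal (\<tau> * measure M U) \<le> ennreal (D\<^sup>2) * (\<integral>\<^sup>+z\<in>ball x (r + R). G z \<partial>M)"
proof -
  obtain \<rho> where \<rho>: "\<And>y. y \<in> S \<Longrightarrow> 0 < \<rho> y" "\<And>y. y \<in> S \<Longrightarrow> \<rho> y \<le> R"
    "\<And>y. y \<in> S \<Longrightarrow> ennreal (\<tau> * measure M (ball y (\<rho> y))) \<le> (\<integral>\<^sup>+z\<in>ball y (\<rho> y). G z \<partial>M)"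
    using large by metis
  define U where "U = (\<Union>y\<in>S. ball y (\<rho> y))"
  have U: "open U" unfolding U_def by auto
  have sub: "S \<subseteq> U" unfolding U_def
  proof (intro subsetI UN_I)
    fix y assume "y \<in> S" then show "y \<in> ball y (\<rho> y)" using \<rho>(1) by simp
  qed
  have bounded: "U \<subseteq> ball x (r + R)"
  proof
    fix w assume "w \<in> U"
    then obtain y where y: "y \<in> S" "dist y w < \<rho> y" by (auto simp: U_def)
    then have "dist x y < r" "dist y w < R" using S \<rho>(2)[of y] by auto
    then show "w \<in> ball x (r + R)" using dist_triangle[of x w y] by simp
  qed
  define N where "N = density M G"
  have G': "G \<in> borel_measurable M" by simp
  have N: "emeasure N B = (\<integral>\<^sup>+z\<in>B. G z \<partial>M)" if "B \<in> sets borel" for B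
    unfolding N_def using that by (intro emeasure_density G') auto
  have "emeasure M U \<le> ennreal (D\<^sup>2 * (1 / \<tau>)) * emeasure N U"
    unfolding U_def
  proof (rule vitali_transfer)
    fix y assume y: "y \<in> S"
    have "emeasure M (ball y (\<rho> y)) = ennreal (1 / \<tau>) * ennreal (\<tau> * measure M (ball y (\<rho> y)))"
      using \<tau> by (simp add: emeasure_ball ennreal_mult[symmetric])
    also have "\<dots> \<le> ennreal (1 / \<tau>) * emeasure N (ball y (\<rho> y))"
      using \<rho>(3)[OF y] by (intro mult_left_mono) (auto simp: N)
    finally show "emeasure M (ball y (\<rho> y)) \<le> ennreal (1 / \<tau>) * emeasure N (ball y (\<rho> y))" .
  qed (use \<rho> \<tau> in \<open>auto simp: N_def\<close>)
  then have "ennreal \<tau> * emeasure M U \<le> ennreal \<tau> * (ennreal (D\<^sup>2 * (1 / \<tau>)) * emeasure N U)"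
    by (intro mult_left_mono) auto
  also have "\<dots> = ennreal (D\<^sup>2) * emeasure N U"
    using \<tau> by (simp add: mult.assoc[symmetric] ennreal_mult[symmetric] del: ennreal_power)
  also have "emeasure N U \<le> emeasure N (ball x (r + R))"
    using bounded by (intro emeasure_mono) (auto simp: N_def)
  also have "\<dots> = (\<integral>\<^sup>+z\<in>ball x (r + R). G z \<partial>M)" by (rule N) simp
  finally have "ennreal \<tau> * emeasure M U \<le> ennreal (D\<^sup>2) * (\<integral>\<^sup>+z\<in>ball x (r + R). G z \<partial>M)"
    by (simp add: mult_left_mono)
  moreover have "U \<in> fmeasurable M" using fmeasurable_in_ball[OF borel_open[OF U] bounded] .
  ultimately have "ennreal (\<tau> * measure M U) \<le> ennreal (D\<^sup>2) * (\<integral>\<^sup>+z\<in>ball x (r + R). G z \<partial>M)"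
    using \<tau> by (simp add: emeasure_eq_measure2 ennreal_mult)
  then show thesis using that U sub bounded by blast
qed

end

context A_infinity_pair
begin

text \<open>
  With \<open>q = p * s\<close> for the exponent \<open>s\<close> of \<open>average_transfer\<close>, applied to \<open>h = g powr p\<close>. The core
  is \<open>key\<close>, where \<open>l\<close> is any positive number bounding the \<open>q\<close>-average of \<open>g\<close>; a strictly positive
  \<open>l\<close> is needed as the base level of the geometric scale, and letting it decrease to the average at the
  end covers the case of a vanishing average.
\<close>

lemma poincare_transfer:
  assumes p: "1 \<le> p" and PI: "poincare_inequality p M"
  shows "\<exists>q\<ge>1. poincare_inequality q N"
proof -
  obtain c P where c: "0 < c" and P: "0 < P" and PI: "\<And>x r f L. 0 < r \<Longrightarrow> L-lipschitz_on UNIV f \<Longrightarrow>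
      mean_value M (ball x r) (\<lambda>y. \<bar>f y - mean_value M (ball x r) f\<bar>)
      \<le> P * r * (mean_value M (ball x (c * r)) (\<lambda>y. enn2real (lower_lip f y) powr p)) powr (1 / p)"
    using PI unfolding poincare_inequality_def by metis
  obtain C s where C: "0 < C" and s: "2 \<le> s" and transfer:
    "\<And>x r h l. 0 < r \<Longrightarrow> h \<in> borel_measurable borel \<Longrightarrow> (\<And>y. 0 \<le> h y) \<Longrightarrow> 0 < l \<Longrightarrow>
      (\<integral>\<^sup>+y\<in>ball x r. ennreal (h y ^ s) \<partial>N) \<le> ennreal (l ^ s * measure N (ball x r)) \<Longrightarrow>
      (\<integral>\<^sup>+y\<in>ball x r. ennreal (h y) \<partial>M) \<le> ennreal (C * l * measure M (ball x r))"
    using average_transfer by blast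
  define q where "q = p * real s"
  have "2 \<le> real s" using s by simp
  then have "1 * 2 \<le> q" unfolding q_def using p by (intro mult_mono) auto
  then have q: "2 \<le> q" by simp
  have power_q: "(u powr p) ^ s = u powr q" if "0 \<le> u" for u
    using that s p by (cases "u = 0") (auto simp: powr_power q_def mult.commute)
  have K: "1 \<le> K" and D: "1 \<le> D" by (rule N.doubling_constant_ge_1 M.doubling_constant_ge_1)+
  obtain m where m: "1 + 2 * c < 2 ^ m" using real_arch_pow[of 2 "1 + 2 * c"] by auto
  define a where "a = 6 * D\<^sup>2 * (P * C powr (1 / p))"
  have a: "0 < a" unfolding a_def using D P C by simp
  define b where "b = K\<^sup>2 * K ^ m"
  have b: "0 \<le> b" unfolding b_def using K by simp
  have key: "mean_value N (ball x r) (\<lambda>y. \<bar>f y - mean_value N (ball x r) f\<bar>) \<le> 2 * (a * r * (1 + 4 * b)) * l"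
    if r: "0 < r" and f: "L-lipschitz_on UNIV f" and l: "0 < l"
      and le: "mean_value N (ball x ((1 + 2 * c) * r)) (\<lambda>y. enn2real (lower_lip f y) powr q) \<le> l powr q"
    for x r f L l
  proof -
    define g where "g y = enn2real (lower_lip f y)" for y
    let ?B = "ball x r" and ?R = "(1 + 2 * c) * r"
    have L: "0 \<le> L" using f by (rule lipschitz_on_nonneg)
    have g[measurable]: "g \<in> borel_measurable borel"
      unfolding g_def using lower_lip_measurable[OF f] by measurable
    have g0: "0 \<le> g y" for y by (simp add: g_def)
    have gL: "g y \<le> L" for y
      using enn2real_mono[OF lower_lip_le[OF f, of y]] L by (simp add: g_def)
    have fm[measurable]: "f \<in> borel_measurable borel"
      using lipschitz_on_continuous_on[OF f] by (rule borel_measurable_continuous_onI)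
    have R: "0 < ?R" using c r by simp
    have g_int: "(\<integral>\<^sup>+y\<in>ball x ?R. ennreal (g y powr q) \<partial>N) \<le> ennreal (l powr q * measure N (ball x ?R))"
      using le R q unfolding g_def[symmetric]
      by (subst N.mean_value_le_iff[where b = "L powr q"]) (auto intro!: powr_mono2 g0 gL)
    let ?cM = "mean_value M ?B f"
    \<comment> \<open>Where the maximal function of \<open>g powr q\<close> is at most \<open>t powr q\<close>, telescoping applies. The balls
      \<open>ball y (c * \<rho>)\<close> with \<open>\<rho> \<le> 2 * r\<close> lie in \<open>ball x ?R\<close>.\<close>
    have good: "\<bar>f y - ?cM\<bar> \<le> a * r * t"
      if y: "y \<in> ?B" and t: "0 < t"
        and small: "\<And>\<rho>. 0 < \<rho> \<Longrightarrow> \<rho> \<le> 2 * c * r \<Longrightarrow>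
          (\<integral>\<^sup>+z\<in>ball y \<rho>. ennreal (g z powr q) \<partial>N) \<le> ennreal (t powr q * measure N (ball y \<rho>))" for y t
    proof -
      have "mean_value M (ball y \<rho>) (\<lambda>z. \<bar>f z - mean_value M (ball y \<rho>) f\<bar>) \<le> P * C powr (1 / p) * t * \<rho>"
        if \<rho>: "0 < \<rho>" "\<rho> \<le> 2 * r" for \<rho>
      proof -
        have c\<rho>: "0 < c * \<rho>" "c * \<rho> \<le> 2 * c * r" using c \<rho> by auto
        have "(\<integral>\<^sup>+z\<in>ball y (c * \<rho>). ennreal (g z powr p) \<partial>M) \<le> ennreal (C * t powr p * measure M (ball y (c * \<rho>)))"
          using small[OF c\<rho>] t g0 by (intro transfer c\<rho>) (auto simp: power_q)
        then have "mean_value M (ball y (c * \<rho>)) (\<lambda>z. g z powr p) \<le> C * t powr p"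
          using c\<rho>(1) C p by (subst (asm) M.mean_value_le_iff[where b = "L powr p"]) (auto intro!: powr_mono2 g0 gL)
        then have "mean_value M (ball y (c * \<rho>)) (\<lambda>z. g z powr p) powr (1 / p) \<le> (C * t powr p) powr (1 / p)"
          using p by (intro powr_mono2 mean_value_nonneg) auto
        also have "\<dots> = C powr (1 / p) * t" using p t by (simp add: powr_mult powr_powr)
        finally have "P * \<rho> * mean_value M (ball y (c * \<rho>)) (\<lambda>z. g z powr p) powr (1 / p) \<le> P * \<rho> * (C powr (1 / p) * t)"
          using P \<rho> by (intro mult_left_mono) auto
        with PI[OF \<rho>(1) f, of y] show ?thesis by (simp add: g_def mult_ac)
      qed
      from M.telescoping[OF f r y this] show ?thesis by (simp add: a_def mult_ac)
    qed
    have "measure N (ball x ?R) \<le> K ^ m * measure N ?B"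
      using m r by (intro N.measure_ball_comparison subset_ball) auto
    then have "K\<^sup>2 * l powr q * measure N (ball x ?R) \<le> K\<^sup>2 * l powr q * (K ^ m * measure N ?B)"
      by (rule mult_left_mono) simp
    then have R_le: "K\<^sup>2 * (l powr q * measure N (ball x ?R)) \<le> b * l powr q * measure N ?B"
      unfolding b_def by (simp only: mult_ac)
    \<comment> \<open>The tail at level \<open>a * r * l * 2 ^ k\<close> decays like \<open>(2 powr (- q)) ^ k \<le> (1/4) ^ k\<close>, and
      \<open>2 * (1/4) < 1\<close>.\<close>
    have "(\<integral>\<^sup>+y\<in>?B. ennreal \<bar>f y - ?cM\<bar> \<partial>N)
        \<le> ennreal (a * r * l * (measure N ?B + b * measure N ?B * 2 / (1 - 2 * (1/4))))"
    proof (rule layer_cake_geometric)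
      fix k
      let ?t = "l * 2 ^ k"
      let ?S = "{y \<in> ?B. a * r * l * 2 ^ k < \<bar>f y - ?cM\<bar>}"
      have t: "0 < ?t" using l by simp
      obtain U where U: "open U" "?S \<subseteq> U" "U \<subseteq> ball x (r + 2 * c * r)"
        "ennreal (?t powr q * measure N U) \<le> ennreal (K\<^sup>2) * (\<integral>\<^sup>+z\<in>ball x (r + 2 * c * r). ennreal (g z powr q) \<partial>N)"
      proof (rule N.maximal_weak_type[where G = "\<lambda>z. ennreal (g z powr q)" and \<tau> = "?t powr q" and S = ?S])
        fix y assume y: "y \<in> ?S"
        show "\<exists>\<rho>>0. \<rho> \<le> 2 * c * r \<and>
            ennreal (?t powr q * measure N (ball y \<rho>)) \<le> (\<integral>\<^sup>+z\<in>ball y \<rho>. ennreal (g z powr q) \<partial>N)"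
        proof (rule ccontr)
          assume "\<not> ?thesis"
          then have "\<bar>f y - ?cM\<bar> \<le> a * r * ?t"
            using y t by (intro good) (auto simp: not_le intro: less_imp_le)
          with y show False by (simp add: mult_ac)
        qed
      qed (use t in auto)
      have R_eq: "r + 2 * c * r = ?R" by (simp add: algebra_simps)
      have "ennreal (?t powr q * measure N U) \<le> ennreal (K\<^sup>2) * ennreal (l powr q * measure N (ball x ?R))"
        using U(4) g_int unfolding R_eq by (meson mult_left_mono order_trans zero_le)
      also have "\<dots> = ennreal (K\<^sup>2 * (l powr q * measure N (ball x ?R)))"
        by (rule ennreal_mult[symmetric]) auto
      finally have "?t powr q * measure N U \<le> K\<^sup>2 * (l powr q * measure N (ball x ?R))"
        by (subst (asm) ennreal_le_iff) auto
      with R_le have "?t powr q * measure N U \<le> b * l powr q * measure N ?B" by linarith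
      then have "l powr q * ((2 ^ k) powr q * measure N U) \<le> l powr q * (b * measure N ?B)"
        using l by (simp add: powr_mult mult_ac)
      then have *: "(2 ^ k) powr q * measure N U \<le> b * measure N ?B"
        by (rule mult_left_le_imp_le) (use l in simp)
      have "(4::real) ^ k = (2 ^ k) powr 2" by (simp add: power2_eq_square power_mult_distrib[symmetric])
      also have "\<dots> \<le> (2 ^ k) powr q" using q by (intro powr_mono) auto
      finally have "4 ^ k * measure N U \<le> b * measure N ?B"
        using * mult_right_mono[of "4 ^ k" "(2 ^ k) powr q" "measure N U"] by simp
      then have "measure N U \<le> b * measure N ?B * (1/4) ^ k" by (simp add: power_divide field_simps)
      moreover have "measure N ?S \<le> measure N U"
      proof (intro measure_mono_fmeasurable U(2))
        have "?S = ?B \<inter> {y. a * r * l * 2 ^ k < \<bar>f y - ?cM\<bar>}" by auto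
        then show "?S \<in> sets N" by simp
        show "U \<in> fmeasurable N" using N.fmeasurable_in_ball[OF borel_open[OF U(1)] U(3)] .
      qed
      ultimately show "measure N ?S \<le> b * measure N ?B * (1/4) ^ k" by linarith
    qed (use a r l b in auto)
    also have "a * r * l * (measure N ?B + b * measure N ?B * 2 / (1 - 2 * (1/4))) = a * r * (1 + 4 * b) * l * measure N ?B"
      by (simp add: algebra_simps)
    finally have "mean_value N ?B (\<lambda>y. \<bar>f y - ?cM\<bar>) \<le> a * r * (1 + 4 * b) * l"
      using r a b l
      by (subst (asm) N.mean_value_le_iff[where b = "L * r + \<bar>f x - ?cM\<bar>"])
         (auto intro!: lipschitz_deviation_bounded[OF f])
    with N.mean_value_recenter[OF f r, of x ?cM] show ?thesis by simp
  qed
  have "poincare_inequality q N"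
    unfolding poincare_inequality_def
  proof (intro exI conjI allI impI)
    show "0 < 1 + 2 * c" using c by simp
    show "0 < 2 * a * (1 + 4 * b)" using a b by simp
    fix x :: 'a and r :: real and f :: "'a \<Rightarrow> real"
    assume "r > 0 \<and> (\<exists>L. L-lipschitz_on UNIV f)"
    then obtain L where r: "0 < r" and f: "L-lipschitz_on UNIV f" by blast
    let ?X = "mean_value N (ball x ((1 + 2 * c) * r)) (\<lambda>y. enn2real (lower_lip f y) powr q)"
    let ?Y = "mean_value N (ball x r) (\<lambda>y. \<bar>f y - mean_value N (ball x r) f\<bar>)"
    let ?A = "2 * a * (1 + 4 * b) * r"
    have X: "0 \<le> ?X" by (intro mean_value_nonneg) simp
    have A: "0 < ?A" using a b r by simp
    have "?Y / ?A \<le> l" if l: "?X powr (1 / q) < l" for l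
    proof -
      have "0 \<le> ?X powr (1 / q)" by simp
      then have l0: "0 < l" using l by linarith
      have "?X = (?X powr (1 / q)) powr q" using X q by (simp add: powr_powr)
      also have "\<dots> \<le> l powr q" using l q by (intro powr_mono2) auto
      finally have "?Y \<le> 2 * (a * r * (1 + 4 * b)) * l" by (rule key[OF r f l0])
      then show ?thesis using A by (simp add: pos_divide_le_eq mult_ac)
    qed
    then have "?Y / ?A \<le> ?X powr (1 / q)" by (rule dense_ge)
    then show "?Y \<le> 2 * a * (1 + 4 * b) * r * ?X powr (1 / q)"
      using A by (simp add: pos_divide_le_eq mult_ac)
  qed
  then show ?thesis using q by (intro exI[of _ q]) simp
qed

end

theorem theorem1p6:
  fixes \<mu> \<nu> :: "'a::polish_space measure" and D p :: real
  assumes "metric_measure_space \<mu>"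
    and "geodesic_space TYPE('a)"
    and "doubling_measure D \<mu>"
    and "1 \<le> p"
    and "poincare_inequality p \<mu>"
    and "\<nu> \<in> A_infinity \<mu>"
  shows "metric_measure_space \<nu> \<and> (\<exists>q\<ge>1. poincare_inequality q \<nu>)"
proof -
  have "emeasure \<mu> (ball x r) < \<infinity>" for x r
    using assms(1) by (cases "0 < r") (auto simp: metric_measure_space_def ball_empty)
  then interpret M: doubling_radon \<mu> D
    using assms(1,3) by unfold_locales (auto simp: metric_measure_space_def doubling_measure_def)
  obtain K where "doubling_radon \<nu> K" using M.A_infinity_doubling[OF assms(2,6)] by blast
  then interpret N: doubling_radon \<nu> K .
  obtain \<epsilon> \<delta> where ed: "0 < \<epsilon>" "\<epsilon> < 1" "0 < \<delta>" "\<delta> < 1"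
    and A: "\<forall>x r E. r > 0 \<and> E \<in> sets borel \<and> E \<subseteq> ball x r \<and>
           emeasure \<nu> E \<le> ennreal \<delta> * emeasure \<nu> (ball x r) \<longrightarrow>
           emeasure \<mu> E \<le> ennreal \<epsilon> * emeasure \<mu> (ball x r)"
    using assms(6) unfolding A_infinity_def mem_Collect_eq by (elim conjE exE)
  interpret A_infinity_pair \<mu> \<nu> D K \<epsilon> \<delta>
  proof
    fix x :: 'a and r E
    assume r: "0 < r" and E: "E \<in> sets borel" "E \<subseteq> ball x r"
      and le: "measure \<nu> E \<le> \<delta> * measure \<nu> (ball x r)"
    have "ennreal (measure \<nu> E) \<le> ennreal (\<delta> * measure \<nu> (ball x r))" using le by (rule ennreal_leI)
    then have "emeasure \<nu> E \<le> ennreal \<delta> * emeasure \<nu> (ball x r)"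
      using ed emeasure_eq_measure2[OF N.fmeasurable_in_ball[OF E]]
      by (simp add: N.emeasure_ball ennreal_mult)
    then have "emeasure \<mu> E \<le> ennreal \<epsilon> * emeasure \<mu> (ball x r)" using A r E by blast
    then show "measure \<mu> E \<le> \<epsilon> * measure \<mu> (ball x r)"
      using ed emeasure_eq_measure2[OF M.fmeasurable_in_ball[OF E]]
      by (simp add: M.emeasure_ball ennreal_mult[symmetric])
  qed (use ed in auto)
  have "metric_measure_space \<nu>"
    using N.radon N.ball_pos N.ball_finite by (simp add: metric_measure_space_def)
  then show ?thesis using poincare_transfer[OF assms(4,5)] by blast
qed

end
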